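(* There exists a superspeedable real number which is Schnorr random.
   Context: A left-approximation of a real $x$ is a computable increasing sequence $(x_n)_n$ of rationals converging to $x$; $x$ is superspeedable if it has a left-approximation with $\limsup_{n\to\infty}\frac{x_{n+1}-x_n}{x-x_n}=1$. A Schnorr test is a sequence $(U_n)_{n\in\mathbb{N}}$ of uniformly effectively open subsets of $\mathbb{R}$ with Lebesgue measure $\mu(U_n)=2^{-n}$ for all $n$; it covers $x$ if $x\in\bigcap_n U_n$. A real is Schnorr random if no Schnorr test covers it. *)

theory Defs
  imports "HOL-Analysis.Analysis" "HOL-Library.Nat_Bijection"
begin

(* The (total) general recursive functions: the least class of number-theoretic functions
   containing the basic functions and closed under composition, primitive recursion and
   minimisation of regular functions. Only unary functions are used; a function of several
   arguments is presented as a unary function of the Cantor pairing prod_encode. *)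
inductive computable :: "(nat \<Rightarrow> nat) \<Rightarrow> bool" where
  zero: "computable (\<lambda>_. 0)"
| succ: "computable Suc"
| proj1: "computable (\<lambda>n. fst (prod_decode n))"
| proj2: "computable (\<lambda>n. snd (prod_decode n))"
| pair: "computable f \<Longrightarrow> computable g \<Longrightarrow> computable (\<lambda>n. prod_encode (f n, g n))"
| comp: "computable f \<Longrightarrow> computable g \<Longrightarrow> computable (\<lambda>n. f (g n))"
| prec: "computable f \<Longrightarrow> computable g \<Longrightarrow>
    computable (\<lambda>n. case prod_decode n of (a, m) \<Rightarrow>
      rec_nat (f a) (\<lambda>k r. g (prod_encode (a, prod_encode (k, r)))) m)"
| mu: "computable f \<Longrightarrow> (\<And>a. \<exists>n. f (prod_encode (a, n)) = 0) \<Longrightarrow>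
    computable (\<lambda>a. LEAST n. f (prod_encode (a, n)) = 0)"

definition computable_rat_seq :: "(nat \<Rightarrow> rat) \<Rightarrow> bool" where
  "computable_rat_seq q \<longleftrightarrow>
    (\<exists>a b c. computable a \<and> computable b \<and> computable c \<and>
      (\<forall>n. q n = (of_nat (a n) - of_nat (b n)) / of_nat (Suc (c n))))"

definition left_approximation :: "(nat \<Rightarrow> rat) \<Rightarrow> real \<Rightarrow> bool" where
  "left_approximation q x \<longleftrightarrow>
    computable_rat_seq q \<and> strict_mono q \<and> (\<lambda>n. real_of_rat (q n)) \<longlonglongrightarrow> x"

(* Strict monotonicity gives q n < x, so the quotient below never divides by 0.
   The limsup is taken in the extended reals. *)
definition superspeedable :: "real \<Rightarrow> bool" where
  "superspeedable x \<longleftrightarrow>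
    (\<exists>q. left_approximation q x \<and>
      limsup (\<lambda>n. ereal ((real_of_rat (q (Suc n)) - real_of_rat (q n)) /
                         (x - real_of_rat (q n)))) = 1)"

(* U n is the union of a sequence of open intervals with rational endpoints, computable
   uniformly in n; an interval is empty when its left endpoint is not below its right one. *)
definition uniformly_effectively_open :: "(nat \<Rightarrow> real set) \<Rightarrow> bool" where
  "uniformly_effectively_open U \<longleftrightarrow>
    (\<exists>a b. computable_rat_seq a \<and> computable_rat_seq b \<and>
      (\<forall>n. U n = (\<Union>k. {real_of_rat (a (prod_encode (n, k))) <..<
                        real_of_rat (b (prod_encode (n, k)))})))"

definition schnorr_test :: "(nat \<Rightarrow> real set) \<Rightarrow> bool" where
  "schnorr_test U \<longleftrightarrow>
    uniformly_effectively_open U \<and> (\<forall>n. emeasure lborel (U n) = ennreal (1 / 2 ^ n))"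

definition covers :: "(nat \<Rightarrow> real set) \<Rightarrow> real \<Rightarrow> bool" where
  "covers U x \<longleftrightarrow> x \<in> (\<Inter>n. U n)"

definition schnorr_random :: "real \<Rightarrow> bool" where
  "schnorr_random x \<longleftrightarrow> \<not> (\<exists>U. schnorr_test U \<and> covers U x)"

end

(* The limit x of the construction avoids one member of every Schnorr test. A test only
   contributes to the set to be avoided when its measure is verified to lie within
   weight (k + 1) of its final value, for the next k; stage s has the least such k (or s) as its
   level. In between, nothing is added, so that after the last stage t of level at most k all
   further additions have tiny total measure, even if some of the tests are not total.
   At every stage the approximation first moves right by weight (level s), and then to the point p
   minimising a * p - |avoided part of [0, p)|, where the slope a < 1 increases with the level.
   Minimality makes the avoided set have density at most a to the right of p. So a limit x inside
   an avoided open set is impossible, and the slack between the slopes bounds the movement after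
   stage t by a negligible fraction of the jump made at stage t. *)
theory Submission
  imports Defs "HOL-Real_Asymp.Real_Asymp"
begin

section \<open>Closure properties of the computable functions\<close>

text \<open>Schnorr tests cannot be listed effectively, so every program has to be run, also one
  that stalls or describes no test. The exactly prescribed measure of a test helps: the part of a
  genuine test found so far comes within every positive distance of the final measure, and this is
  visible at a finite stage. Program e contributes only its member of measure
  \<open>weight e\<close>, so that the contributions are summable. The weights are 2^-(k^2), so that
  weight (k + 1) = weight k / (2 * 4^k). After the last stage of level at most k, the measure still
  added and the later forced jumps are each at most a linear factor times weight (k + 1), while the
  slopes of levels k and k + 1 differ by 2^-(k + 2). Dividing by that difference leaves movement of
  order k * 2^-k * weight k, against a jump of at least weight k. Positions and avoided sets live on
  dyadic grids and are handled by natural numbers, which makes every comparison decidable; real sets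
  and measures enter only in the verification.\<close>

lemma computable_id: "computable (\<lambda>n. n)"
  using computable.pair[OF computable.proj1 computable.proj2] by simp

lemma computable_const: "computable (\<lambda>_. c)"
proof (induction c)
  case 0
  show ?case by (rule computable.zero)
next
  case (Suc c)
  show ?case using computable.comp[OF computable.succ Suc] by simp
qed

lemma computable_Suc: "computable f \<Longrightarrow> computable (\<lambda>n. Suc (f n))"
  using computable.comp[OF computable.succ] .

lemma computable_fst: "computable f \<Longrightarrow> computable (\<lambda>n. fst (prod_decode (f n)))"
  using computable.comp[OF computable.proj1] .

lemma computable_snd: "computable f \<Longrightarrow> computable (\<lambda>n. snd (prod_decode (f n)))"
  using computable.comp[OF computable.proj2] .

text \<open>The argument \<open>n\<close> itself is the parameter of the primitive recursion, so the
  step function may depend on it.\<close>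

lemma computable_rec:
  assumes "computable a" "computable m"
    and "computable (\<lambda>p. g (fst (prod_decode p)) (fst (prod_decode (snd (prod_decode p))))
                             (snd (prod_decode (snd (prod_decode p)))))"
  shows "computable (\<lambda>n. rec_nat (a n) (g n) (m n))"
  using computable.comp[OF computable.prec[OF assms(1,3)]
      computable.pair[OF computable_id assms(2)]] by simp

lemma computable_add:
  assumes "computable f" "computable g"
  shows "computable (\<lambda>n. f n + g n)"
proof -
  have "rec_nat a (\<lambda>k r. Suc r) b = a + b" for a b
    by (induction b) auto
  moreover have "computable (\<lambda>n. rec_nat (f n) (\<lambda>k r. Suc r) (g n))"
    by (intro computable_rec assms computable_Suc computable_snd computable_id)
  ultimately show ?thesis by simp
qed

lemma computable_mult:
  assumes "computable f" "computable g"
  shows "computable (\<lambda>n. f n * g n)"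
proof -
  have "rec_nat 0 (\<lambda>k r. r + a) b = a * b" for a b :: nat
    by (induction b) auto
  moreover have "computable (\<lambda>n. rec_nat 0 (\<lambda>k r. r + f n) (g n))"
    by (intro computable_rec assms computable_add computable_snd computable_id computable.zero
        computable.comp[OF assms(1) computable.proj1])
  ultimately show ?thesis by simp
qed

lemma computable_diff:
  assumes "computable f" "computable g"
  shows "computable (\<lambda>n. f n - g n)"
proof -
  have "rec_nat 0 (\<lambda>k r. k) b = b - 1" for b :: nat
    by (induction b) auto
  moreover have "computable (\<lambda>n. rec_nat 0 (\<lambda>k r. k) (h n))" if "computable h" for h
    by (intro computable_rec that computable_fst computable_snd computable_id computable.zero)
  ultimately have pred: "computable h \<Longrightarrow> computable (\<lambda>n. h n - 1)" for h
    by simp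
  have "rec_nat a (\<lambda>k r. r - 1) b = a - b" for a b :: nat
    by (induction b) auto
  moreover have "computable (\<lambda>n. rec_nat (f n) (\<lambda>k r. r - 1) (g n))"
    by (intro computable_rec assms pred computable_snd computable_id)
  ultimately show ?thesis by simp
qed

lemma computable_power:
  assumes "computable f" "computable g"
  shows "computable (\<lambda>n. f n ^ g n)"
proof -
  have "rec_nat 1 (\<lambda>k r. r * a) b = a ^ b" for a b :: nat
    by (induction b) auto
  moreover have "computable (\<lambda>n. rec_nat 1 (\<lambda>k r. r * f n) (g n))"
    by (intro computable_rec assms computable_mult computable_snd computable_id computable_const
        computable.comp[OF assms(1) computable.proj1])
  ultimately show ?thesis by simp
qed

lemma computable_sum:
  assumes "computable b"
    and "computable (\<lambda>p. f (fst (prod_decode p)) (snd (prod_decode p)))"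
  shows "computable (\<lambda>n. \<Sum>i<b n. f n i)"
proof -
  have eq: "rec_nat 0 (\<lambda>k r. r + h k) m = (\<Sum>i<m. h i)" for m and h :: "nat \<Rightarrow> nat"
    by (induction m) auto
  have f: "computable (\<lambda>p. f (fst (prod_decode p)) (fst (prod_decode (snd (prod_decode p)))))"
    using computable.comp[OF assms(2) computable.pair[OF computable.proj1
          computable.comp[OF computable.proj1 computable.proj2]]] by simp
  have "computable (\<lambda>n. rec_nat 0 (\<lambda>k r. r + f n k) (b n))"
    by (intro computable_rec assms(1) computable_add f computable_snd computable_id computable.zero)
  then show ?thesis
    by (simp only: eq)
qed

section \<open>Decidable predicates, bounded quantifiers and search\<close>

definition decidable :: "(nat \<Rightarrow> bool) \<Rightarrow> bool" where
  "decidable P \<longleftrightarrow> computable (\<lambda>n. of_bool (P n))"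

lemma decidable_le:
  assumes "computable f" "computable g"
  shows "decidable (\<lambda>n. f n \<le> g n)"
proof -
  have "1 - (a - b) = of_bool (a \<le> b)" for a b :: nat
    by auto
  then show ?thesis
    using computable_diff[OF computable_const[of 1] computable_diff[OF assms]]
    by (simp add: decidable_def)
qed

lemma decidable_less:
  assumes "computable f" "computable g"
  shows "decidable (\<lambda>n. f n < g n)"
  using decidable_le[OF computable_Suc[OF assms(1)] assms(2)] by (simp add: Suc_le_eq)

lemma decidable_not:
  assumes "decidable P"
  shows "decidable (\<lambda>n. \<not> P n)"
proof -
  have "1 - of_bool b = (of_bool (\<not> b) :: nat)" for b
    by auto
  then show ?thesis
    using computable_diff[OF computable_const[of 1] assms[unfolded decidable_def]]
    by (simp only: decidable_def)
qed

lemma decidable_conj: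
  assumes "decidable P" "decidable Q"
  shows "decidable (\<lambda>n. P n \<and> Q n)"
  using computable_mult[OF assms[unfolded decidable_def]]
  by (simp add: decidable_def of_bool_conj)

lemma decidable_disj:
  assumes "decidable P" "decidable Q"
  shows "decidable (\<lambda>n. P n \<or> Q n)"
  using decidable_not[OF decidable_conj[OF decidable_not[OF assms(1)] decidable_not[OF assms(2)]]]
  by simp

lemma decidable_imp:
  assumes "decidable P" "decidable Q"
  shows "decidable (\<lambda>n. P n \<longrightarrow> Q n)"
  using decidable_disj[OF decidable_not[OF assms(1)] assms(2)]
  by simp

lemma decidable_eq:
  assumes "computable f" "computable g"
  shows "decidable (\<lambda>n. f n = g n)"
proof -
  have "f n = g n \<longleftrightarrow> f n \<le> g n \<and> g n \<le> f n" for n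
    by auto
  then show ?thesis
    using decidable_conj[OF decidable_le[OF assms] decidable_le[OF assms(2,1)]]
    by (simp only:)
qed

lemma computable_of_bool: "decidable P \<Longrightarrow> computable (\<lambda>n. of_bool (P n))"
  by (simp add: decidable_def)

lemma computable_if:
  assumes "decidable P" "computable f" "computable g"
  shows "computable (\<lambda>n. if P n then f n else g n)"
proof -
  have "of_bool b * x + of_bool (\<not> b) * y = (if b then x else y)" for b and x y :: nat
    by auto
  then show ?thesis
    using computable_add[OF computable_mult[OF computable_of_bool[OF assms(1)] assms(2)]
        computable_mult[OF computable_of_bool[OF decidable_not[OF assms(1)]] assms(3)]]
    by (simp only:)
qed

lemma decidable_ex_less:
  assumes "computable b"
    and "decidable (\<lambda>p. P (fst (prod_decode p)) (snd (prod_decode p)))"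
  shows "decidable (\<lambda>n. \<exists>i<b n. P n i)"
proof -
  have "0 < (\<Sum>i<b n. of_bool (P n i) :: nat) \<longleftrightarrow> (\<exists>i<b n. P n i)" for n
    by (auto simp: zero_less_iff_neq_zero)
  then show ?thesis
    using decidable_less[OF computable_const[of 0]
        computable_sum[OF assms(1) assms(2)[unfolded decidable_def]]]
    by (simp only:)
qed

lemma decidable_all_less:
  assumes "computable b"
    and "decidable (\<lambda>p. P (fst (prod_decode p)) (snd (prod_decode p)))"
  shows "decidable (\<lambda>n. \<forall>i<b n. P n i)"
  using decidable_not[OF decidable_ex_less[OF assms(1) decidable_not[OF assms(2)]]]
  by simp

lemma decidable_ex_le:
  assumes "computable b"
    and "decidable (\<lambda>p. P (fst (prod_decode p)) (snd (prod_decode p)))"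
  shows "decidable (\<lambda>n. \<exists>i\<le>b n. P n i)"
  using decidable_ex_less[OF computable_Suc[OF assms(1)] assms(2)] by (simp add: less_Suc_eq_le)

text \<open>\<open>mu\<close> searches for a zero, hence the characteristic function of the
  negation.\<close>

lemma computable_Least:
  assumes "decidable (\<lambda>p. P (fst (prod_decode p)) (snd (prod_decode p)))"
    and "\<And>n. \<exists>y. P n y"
  shows "computable (\<lambda>n. LEAST y. P n y)"
  using computable.mu[OF decidable_not[OF assms(1), unfolded decidable_def]] assms(2) by simp

lemma computable_div:
  assumes "computable f" "computable g"
  shows "computable (\<lambda>n. f n div g n)"
proof -
  \<comment> \<open>The disjunct \<open>n = 0\<close> keeps the search total and yields the
    convention \<open>m div 0 = 0\<close>.\<close>
  have eq: "(LEAST q. n = 0 \<or> m < Suc q * n) = m div n" for m n :: nat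
  proof (cases "n = 0")
    case False
    show ?thesis
    proof (rule Least_equality)
      show "n = 0 \<or> m < Suc (m div n) * n"
        using False dividend_less_div_times[of n m] by simp
      show "m div n \<le> q" if "n = 0 \<or> m < Suc q * n" for q
        using that False by (metis div_less_iff_less_mult less_Suc_eq_le neq0_conv)
    qed
  qed (simp add: Least_equality)
  have "\<exists>q. g n = 0 \<or> f n < Suc q * g n" for n
    using dividend_less_div_times[of "g n" "f n"] by (intro exI[of _ "f n div g n"]) auto
  then have "computable (\<lambda>n. LEAST q. g n = 0 \<or> f n < Suc q * g n)"
    using assms[THEN computable.comp, OF computable.proj1]
    by (intro computable_Least decidable_disj decidable_eq decidable_less computable_mult
        computable_Suc computable_const computable_snd computable_id)
  then show ?thesis
    by (simp only: eq)
qed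

lemmas computable_intros =
  computable_id computable_const computable_Suc computable_fst computable_snd computable.pair
  computable_add computable_mult computable_diff computable_power computable_div computable_sum
  computable_of_bool computable_if decidable_le decidable_less decidable_eq decidable_not
  decidable_conj decidable_disj decidable_imp decidable_ex_less decidable_all_less decidable_ex_le

text \<open>Membership of \<open>m\<close> is binary digit number \<open>m\<close> of the code; its
  parity is phrased through \<open>div\<close>, already known to be computable.\<close>

lemma decidable_set_decode:
  assumes "computable f" "computable g"
  shows "decidable (\<lambda>n. f n \<in> set_decode (g n))"
proof -
  have "m \<in> set_decode S \<longleftrightarrow> S div 2 ^ m \<noteq> 2 * (S div 2 ^ m div 2)" for m S :: nat
    unfolding set_decode_def using dvd_mult_div_cancel[of 2 "S div 2 ^ m"]
    by (metis dvd_triv_left mem_Collect_eq)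
  then show ?thesis
    using assms by (simp only:) (intro computable_intros)
qed

section \<open>A universal function\<close>

definition fact_code :: "nat \<Rightarrow> nat \<Rightarrow> nat \<Rightarrow> nat" where
  "fact_code c x v = prod_encode (c, prod_encode (x, v))"

text \<open>The last rule keeps the regularity condition of \<open>mu\<close>: a minimisation that
  fails to terminate denotes no function.\<close>

inductive codes :: "nat \<Rightarrow> (nat \<Rightarrow> nat) \<Rightarrow> bool" where
  "codes (prod_encode (0, 0)) (\<lambda>_. 0)"
| "codes (prod_encode (1, 0)) Suc"
| "codes (prod_encode (2, 0)) (\<lambda>n. fst (prod_decode n))"
| "codes (prod_encode (3, 0)) (\<lambda>n. snd (prod_decode n))"
| "codes c f \<Longrightarrow> codes d g \<Longrightarrow>
    codes (prod_encode (4, prod_encode (c, d))) (\<lambda>n. prod_encode (f n, g n))"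
| "codes c f \<Longrightarrow> codes d g \<Longrightarrow> codes (prod_encode (5, prod_encode (c, d))) (\<lambda>n. f (g n))"
| "codes c f \<Longrightarrow> codes d g \<Longrightarrow> codes (prod_encode (6, prod_encode (c, d)))
    (\<lambda>n. case prod_decode n of (a, m) \<Rightarrow>
      rec_nat (f a) (\<lambda>k r. g (prod_encode (a, prod_encode (k, r)))) m)"
| "codes c f \<Longrightarrow> (\<And>a. \<exists>n. f (prod_encode (a, n)) = 0) \<Longrightarrow>
    codes (prod_encode (7, c)) (\<lambda>a. LEAST n. f (prod_encode (a, n)) = 0)"

lemma computable_imp_codes: "computable f \<Longrightarrow> \<exists>c. codes c f"
proof (induction rule: computable.induct)
  case (mu f)
  then show ?case using codes.intros(8) by blast
qed (blast intro: codes.intros)+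

text \<open>A set \<open>A\<close> of facts ``program \<open>c\<close> maps \<open>x\<close> to \<open>v\<close>'' is a certificate if every one of its
  facts follows in one step from others. Such a step leads to smaller programs, or to the same
  program at a smaller recursion argument, so that circular certificates do no harm.\<close>

definition justified :: "nat set \<Rightarrow> nat \<Rightarrow> nat \<Rightarrow> nat \<Rightarrow> bool" where
  "justified A c x v \<longleftrightarrow>
    (let t = fst (prod_decode c); d = snd (prod_decode c);
         d1 = fst (prod_decode d); d2 = snd (prod_decode d);
         x1 = fst (prod_decode x); x2 = snd (prod_decode x) in
      t = 0 \<and> v = 0 \<or>
      t = 1 \<and> v = Suc x \<or>
      t = 2 \<and> v = x1 \<or>
      t = 3 \<and> v = x2 \<or>
      t = 4 \<and> fact_code d1 x (fst (prod_decode v)) \<in> A \<and>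
              fact_code d2 x (snd (prod_decode v)) \<in> A \<or>
      t = 5 \<and> (\<exists>w. fact_code d2 x w \<in> A \<and> fact_code d1 w v \<in> A) \<or>
      t = 6 \<and> x2 = 0 \<and> fact_code d1 x1 v \<in> A \<or>
      t = 6 \<and> x2 \<noteq> 0 \<and> (\<exists>w. fact_code c (prod_encode (x1, x2 - 1)) w \<in> A \<and>
              fact_code d2 (prod_encode (x1, prod_encode (x2 - 1, w))) v \<in> A) \<or>
      t = 7 \<and> fact_code d (prod_encode (x, v)) 0 \<in> A \<and>
              (\<forall>n<v. \<exists>w. w \<noteq> 0 \<and> fact_code d (prod_encode (x, n)) w \<in> A))"

definition certificate :: "nat set \<Rightarrow> bool" where
  "certificate A \<longleftrightarrow> (\<forall>c x v. fact_code c x v \<in> A \<longrightarrow> justified A c x v)"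

text \<open>Induction on the program. Primitive recursion needs a second induction on the recursion
  argument, because a fact may rest on a fact about the same code at the preceding argument.\<close>

lemma certificate_sound:
  assumes "codes c f" "certificate A" "fact_code c x v \<in> A"
  shows "v = f x"
  using assms(1,3)
proof (induction arbitrary: x v rule: codes.induct)
  case (7 c f d g)
  let ?e = "prod_encode (6, prod_encode (c, d))"
  obtain a m where x: "x = prod_encode (a, m)"
    by (metis prod_decode_inverse surj_pair)
  have "v = rec_nat (f a) (\<lambda>k r. g (prod_encode (a, prod_encode (k, r)))) m"
    using 7(5) unfolding x
  proof (induction m arbitrary: v)
    case 0
    then have "justified A ?e (prod_encode (a, 0)) v"
      using assms(2) by (simp add: certificate_def)
    then show ?case using 7(3) by (simp add: justified_def)
  next
    case (Suc m)
    then have "justified A ?e (prod_encode (a, Suc m)) v"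
      using assms(2) by (simp add: certificate_def)
    then obtain w where "fact_code ?e (prod_encode (a, m)) w \<in> A"
      "fact_code d (prod_encode (a, prod_encode (m, w))) v \<in> A"
      by (auto simp: justified_def)
    then show ?case using 7(4) Suc.IH by simp
  qed
  then show ?case by (simp add: x)
next
  case (8 c f)
  then have "justified A (prod_encode (7, c)) x v"
    using assms(2) by (simp add: certificate_def)
  then have v: "fact_code c (prod_encode (x, v)) 0 \<in> A"
    and less: "\<forall>n<v. \<exists>w. w \<noteq> 0 \<and> fact_code c (prod_encode (x, n)) w \<in> A"
    by (auto simp: justified_def)
  have "f (prod_encode (x, n)) \<noteq> 0" if "n < v" for n
    using less that 8(3) by metis
  then have "(LEAST n. f (prod_encode (x, n)) = 0) = v"
    using 8(3)[OF v] by (intro Least_equality) (metis leI)+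
  then show ?case by simp
next
  case (5 c f d g)
  then have "justified A (prod_encode (4, prod_encode (c, d))) x v"
    using assms(2) by (simp add: certificate_def)
  then show ?case using 5(3)[of x "fst (prod_decode v)"] 5(4)[of x "snd (prod_decode v)"]
    by (auto simp: justified_def) (metis prod.collapse prod_decode_inverse)
next
  case (6 c f d g)
  then have "justified A (prod_encode (5, prod_encode (c, d))) x v"
    using assms(2) by (simp add: certificate_def)
  then show ?case using 6(3,4) by (auto simp: justified_def)
qed (use assms(2) in \<open>force simp: certificate_def justified_def\<close>)+

text \<open>\<open>A\<close> occurs only positively in \<open>justified\<close>. This is what lets
  certificates of subcomputations be united.\<close>

lemma justified_mono:
  assumes "justified A c x v" "A \<subseteq> B"
  shows "justified B c x v"
  using assms(1) unfolding justified_def Let_def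
  by (elim disj_forward conj_forward ex_forward all_forward imp_forward subsetD[OF assms(2)])

lemma certificate_Un: "certificate A \<Longrightarrow> certificate B \<Longrightarrow> certificate (A \<union> B)"
  unfolding certificate_def by (meson Un_iff Un_upper1 Un_upper2 justified_mono)

lemma certificate_UN: "(\<And>i. i \<in> I \<Longrightarrow> certificate (A i)) \<Longrightarrow> certificate (\<Union>i\<in>I. A i)"
  unfolding certificate_def by (meson UN_E UN_upper justified_mono)

lemma fact_code_eq_iff: "fact_code c x v = fact_code c' x' v' \<longleftrightarrow> c = c' \<and> x = x' \<and> v = v'"
  by (simp add: fact_code_def)

lemma certificate_insert:
  "certificate A \<Longrightarrow> justified A c x v \<Longrightarrow> certificate (insert (fact_code c x v) A)"
  unfolding certificate_def
  by (metis fact_code_eq_iff insert_iff justified_mono subset_insertI)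

lemma certificate_extend:
  assumes "finite A" "certificate A" "justified A c x v"
  shows "\<exists>A. finite A \<and> certificate A \<and> fact_code c x v \<in> A"
  using assms certificate_insert by (metis finite_insert insertI1)

text \<open>Each value rests on finitely many others; their certificates are united and the new fact
  is added. For minimisation these are the values at all arguments up to the result.\<close>

lemma certificate_complete:
  assumes "codes c f"
  shows "\<exists>A. finite A \<and> certificate A \<and> fact_code c x (f x) \<in> A"
  using assms
proof (induction arbitrary: x rule: codes.induct)
  case (5 c f d g)
  obtain A where A: "finite A" "certificate A" "fact_code c x (f x) \<in> A" using 5 by blast
  obtain B where B: "finite B" "certificate B" "fact_code d x (g x) \<in> B" using 5 by blast
  show ?case
    using A B by (intro certificate_extend[of "A \<union> B"] certificate_Un) (auto simp: justified_def)
next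
  case (6 c f d g)
  obtain A where A: "finite A" "certificate A" "fact_code c (g x) (f (g x)) \<in> A" using 6 by blast
  obtain B where B: "finite B" "certificate B" "fact_code d x (g x) \<in> B" using 6 by blast
  show ?case
    using A B by (intro certificate_extend[of "A \<union> B"] certificate_Un) (auto simp: justified_def)
next
  case (7 c f d g)
  let ?e = "prod_encode (6, prod_encode (c, d))"
  obtain a m where x: "x = prod_encode (a, m)"
    by (metis prod_decode_inverse surj_pair)
  have "\<exists>A. finite A \<and> certificate A \<and> fact_code ?e (prod_encode (a, m))
      (rec_nat (f a) (\<lambda>k r. g (prod_encode (a, prod_encode (k, r)))) m) \<in> A"
  proof (induction m)
    case 0
    obtain A where "finite A" "certificate A" "fact_code c a (f a) \<in> A" using 7 by blast
    then show ?case
      by (intro certificate_extend[of A]) (auto simp: justified_def)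
  next
    case (Suc m)
    let ?r = "rec_nat (f a) (\<lambda>k r. g (prod_encode (a, prod_encode (k, r)))) m"
    obtain A where A: "finite A" "certificate A" "fact_code ?e (prod_encode (a, m)) ?r \<in> A"
      using Suc by blast
    obtain B where B: "finite B" "certificate B"
      "fact_code d (prod_encode (a, prod_encode (m, ?r)))
        (g (prod_encode (a, prod_encode (m, ?r)))) \<in> B" using 7 by blast
    have "justified (A \<union> B) ?e (prod_encode (a, Suc m))
        (g (prod_encode (a, prod_encode (m, ?r))))"
      using A(3) B(3) by (auto simp: justified_def Let_def)
    then show ?case
      using A B by (intro certificate_extend[of "A \<union> B"] certificate_Un) simp_all
  qed
  then show ?case by (simp add: x)
next
  case (8 c f)
  define v where "v = (LEAST n. f (prod_encode (x, n)) = 0)"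
  have v: "f (prod_encode (x, v)) = 0"
    unfolding v_def using 8(2) by (metis (mono_tags, lifting) LeastI)
  have less: "f (prod_encode (x, n)) \<noteq> 0" if "n < v" for n
    using that not_less_Least unfolding v_def by blast
  have "\<forall>n. \<exists>A. finite A \<and> certificate A \<and>
      fact_code c (prod_encode (x, n)) (f (prod_encode (x, n))) \<in> A"
    using 8(3) by blast
  from choice[OF this] obtain A where "\<forall>n. finite (A n) \<and> certificate (A n) \<and>
      fact_code c (prod_encode (x, n)) (f (prod_encode (x, n))) \<in> A n"
    by blast
  then have A: "\<And>n. finite (A n)" "\<And>n. certificate (A n)"
    "\<And>n. fact_code c (prod_encode (x, n)) (f (prod_encode (x, n))) \<in> A n"
    by blast+
  have "fact_code c (prod_encode (x, v)) 0 \<in> A v"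
    using A(3)[of v] v by simp
  moreover have "\<exists>w. w \<noteq> 0 \<and> fact_code c (prod_encode (x, n)) w \<in> (\<Union>n\<le>v. A n)" if "n < v" for n
    using A(3)[of n] less[OF that] that by (metis UN_I atMost_iff less_imp_le)
  ultimately have "justified (\<Union>n\<le>v. A n) (prod_encode (7, c)) x v"
    by (auto simp: justified_def)
  then show ?case
    unfolding v_def[symmetric] using A(1,2)
    by (intro certificate_extend[of "\<Union>n\<le>v. A n"] certificate_UN) simp_all
qed (rule certificate_extend[of "{}"]; simp add: certificate_def justified_def)+

lemma set_decode_less: "m \<in> set_decode S \<Longrightarrow> m < S"
proof -
  assume "m \<in> set_decode S"
  then have "2 ^ m \<le> S"
    by (simp add: set_decode_def) (metis div_less even_zero leI)
  then show ?thesis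
    using less_exp[of m] by linarith
qed

lemma le_fact_code: "x \<le> fact_code c x v" "v \<le> fact_code c x v"
  unfolding fact_code_def
  by (meson le_prod_encode_1 le_prod_encode_2 le_trans)+

lemma set_decode_fact_codeD:
  assumes "fact_code c x v \<in> set_decode S"
  shows "x < S" "v < S"
  using set_decode_less[OF assms] le_fact_code[where c=c and x=x and v=v] by linarith+

text \<open>The unbounded quantifiers concern members of \<open>set_decode S\<close> or their
  components. All of these are below \<open>S\<close>, so \<open>S\<close> can serve as the
  bound.\<close>

lemma decidable_certificate:
  assumes "computable f"
  shows "decidable (\<lambda>n. certificate (set_decode (f n)))"
proof -
  have cert: "certificate (set_decode S) \<longleftrightarrow> (\<forall>m<S. m \<in> set_decode S \<longrightarrow>
      justified (set_decode S) (fst (prod_decode m)) (fst (prod_decode (snd (prod_decode m))))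
        (snd (prod_decode (snd (prod_decode m)))))" for S
  proof -
    show ?thesis
      unfolding certificate_def
      by (metis fact_code_def fst_conv prod.collapse prod_decode_inverse prod_encode_inverse
          set_decode_less snd_conv)
  qed
  have bounds: "(\<exists>w. fact_code d x w \<in> set_decode S \<and> fact_code d' w v \<in> set_decode S) \<longleftrightarrow>
      (\<exists>w<S. fact_code d x w \<in> set_decode S \<and> fact_code d' w v \<in> set_decode S)"
    "(\<exists>w. fact_code d x w \<in> set_decode S \<and> fact_code d' (prod_encode (y, prod_encode (z, w))) v \<in> set_decode S) \<longleftrightarrow>
      (\<exists>w<S. fact_code d x w \<in> set_decode S \<and> fact_code d' (prod_encode (y, prod_encode (z, w))) v \<in> set_decode S)"
    "(\<exists>w. w \<noteq> 0 \<and> fact_code d x w \<in> set_decode S) \<longleftrightarrow>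
      (\<exists>w<S. w \<noteq> 0 \<and> fact_code d x w \<in> set_decode S)"
    for d x d' v S y z
    by (auto dest: set_decode_fact_codeD(2))
  show ?thesis
    unfolding cert justified_def Let_def bounds
    unfolding fact_code_def
    by (intro computable_intros decidable_set_decode assms computable.comp[OF assms])
qed

text \<open>The argument \<open>s\<close> guesses a value together with an encoded certificate for
  it. The result 0 means that \<open>s\<close> verifies nothing, and \<open>Suc v\<close> reports
  the value \<open>v\<close>; the function is thus total even for partial programs.\<close>

definition universal :: "nat \<Rightarrow> nat \<Rightarrow> nat \<Rightarrow> nat" where
  "universal c x s =
    (if certificate (set_decode (snd (prod_decode s))) \<and>
        fact_code c x (fst (prod_decode s)) \<in> set_decode (snd (prod_decode s))
     then Suc (fst (prod_decode s)) else 0)"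

lemma computable_universal:
  assumes "computable f" "computable g" "computable h"
  shows "computable (\<lambda>n. universal (f n) (g n) (h n))"
  unfolding universal_def fact_code_def
  by (intro computable_intros decidable_certificate decidable_set_decode assms)

lemma universal_complete:
  assumes "computable f"
  shows "\<exists>c. \<forall>x. (\<exists>s. universal c x s = Suc (f x)) \<and> (\<forall>s. universal c x s \<in> {0, Suc (f x)})"
proof -
  obtain c where c: "codes c f"
    using computable_imp_codes[OF assms] by blast
  have "\<exists>s. universal c x s = Suc (f x)" for x
  proof -
    obtain A where "finite A" "certificate A" "fact_code c x (f x) \<in> A"
      using certificate_complete[OF c] by blast
    then have "universal c x (prod_encode (f x, set_encode A)) = Suc (f x)"
      by (simp add: universal_def)
    then show ?thesis by blast
  qed
  moreover have "universal c x s \<in> {0, Suc (f x)}" for x s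
    using certificate_sound[OF c] by (auto simp: universal_def)
  ultimately show ?thesis by blast
qed

section \<open>The construction\<close>

text \<open>One exponent gives the fineness of the grid of a stage, the jump of a level and the
  number of the member taken from test \<open>e\<close>. So all sizes with index at most
  \<open>s\<close> are whole numbers of cells of stage \<open>s\<close>.\<close>

definition resol :: "nat \<Rightarrow> nat" where
  "resol k = k * k"

definition rat_of_code :: "nat \<Rightarrow> real" where
  "rat_of_code t = (real (fst (prod_decode t)) - real (fst (prod_decode (snd (prod_decode t)))))
     / real (Suc (snd (prod_decode (snd (prod_decode t)))))"

text \<open>\<open>q\<close> pairs the number of an interval with a guess for
  \<open>universal\<close>, so that one parameter enumerates everything. A nonzero result is the
  successor of the code of an interval.\<close>

definition interval_code :: "nat \<Rightarrow> nat \<Rightarrow> nat" where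
  "interval_code e q =
    universal e (prod_encode (resol e, fst (prod_decode q))) (snd (prod_decode q))"

definition lower :: "nat \<Rightarrow> nat \<Rightarrow> real" where
  "lower e q = rat_of_code (fst (prod_decode (interval_code e q - 1)))"

definition upper :: "nat \<Rightarrow> nat \<Rightarrow> real" where
  "upper e q = rat_of_code (snd (prod_decode (interval_code e q - 1)))"

text \<open>The comparison of \<open>rat_of_code t\<close> with j / 2^r - u, with denominators
  cleared and negative terms moved to the other side.\<close>

definition code_below :: "nat \<Rightarrow> nat \<Rightarrow> nat \<Rightarrow> nat \<Rightarrow> bool" where
  "code_below t r u j \<longleftrightarrow>
    fst (prod_decode t) * 2 ^ r + u * 2 ^ r * Suc (snd (prod_decode (snd (prod_decode t)))) <
    j * Suc (snd (prod_decode (snd (prod_decode t)))) + fst (prod_decode (snd (prod_decode t))) * 2 ^ r"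

text \<open>Cell number \<open>j\<close> of the grid of stage \<open>u\<close> is the half-open interval from
  \<open>j / 2 ^ resol u - u\<close> to \<open>(j + 1) / 2 ^ resol u - u\<close>.\<close>

definition covered :: "nat \<Rightarrow> nat \<Rightarrow> nat \<Rightarrow> bool" where
  "covered e u j \<longleftrightarrow> (\<exists>q<u. interval_code e q \<noteq> 0 \<and>
     code_below (fst (prod_decode (interval_code e q - 1))) (resol u) u j \<and>
     \<not> code_below (snd (prod_decode (interval_code e q - 1))) (resol u) u (Suc j))"

definition covered_count :: "nat \<Rightarrow> nat \<Rightarrow> nat" where
  "covered_count e u = (\<Sum>j<2 * u * 2 ^ resol u. of_bool (covered e u j))"

text \<open>In cells of stage \<open>u\<close>: the measure found is at most weight e and at least
  weight e - weight (k + 1). The upper bound rejects programs that exceed the measure allowed to a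
  test; \<open>e \<le> k\<close> and \<open>k < u\<close> make the truncated subtractions
  genuine.\<close>

definition reached :: "nat \<Rightarrow> nat \<Rightarrow> nat \<Rightarrow> bool" where
  "reached e k u \<longleftrightarrow> e \<le> k \<and> k < u \<and> covered_count e u \<le> 2 ^ (resol u - resol e) \<and>
     2 ^ (resol u - resol e) \<le> covered_count e u + 2 ^ (resol u - resol (Suc k))"

text \<open>Each pair \<open>e\<close>, \<open>k\<close> triggers at most one stage, which later
  bounds the number of stages of each level.\<close>

definition newly :: "nat \<Rightarrow> nat \<Rightarrow> nat \<Rightarrow> bool" where
  "newly e k u \<longleftrightarrow> reached e k u \<and> (\<forall>u'<u. \<not> reached e k u')"

definition level :: "nat \<Rightarrow> nat" where
  "level s = (LEAST k. s \<le> k \<or> (\<exists>e\<le>k. newly e k s))"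

text \<open>Cell 0 starts at 0 here but at \<open>- u\<close> in the grid of stage \<open>u\<close>,
  hence the shift by \<open>u * 2 ^ resol u\<close>. The quotient finds the coarser cell that
  contains cell \<open>i\<close>.\<close>

definition bad :: "nat \<Rightarrow> nat \<Rightarrow> bool" where
  "bad s i \<longleftrightarrow> (\<exists>u\<le>s. \<exists>k<u. \<exists>e\<le>k. newly e k u \<and>
     i div 2 ^ (resol s - resol u) + u * 2 ^ resol u < 2 * u * 2 ^ resol u \<and>
     covered e u (i div 2 ^ (resol s - resol u) + u * 2 ^ resol u))"

definition bad_count :: "nat \<Rightarrow> nat \<Rightarrow> nat" where
  "bad_count s z = (\<Sum>i<z. of_bool (bad s i))"

definition target :: "nat \<Rightarrow> nat \<Rightarrow> nat" where
  "target s y = y * 2 ^ (resol (Suc s) - resol s) + 2 ^ (resol (Suc s) - resol (level (Suc s)))"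

text \<open>The minimality condition for a = 1 - 1 / 2^(level s + 1), in units of cells, multiplied
  by 2^(level s + 1) and free of subtraction of costs. A finite range suffices because all bad cells
  lie below \<open>s * 2 ^ resol s\<close>.\<close>

definition optimal :: "nat \<Rightarrow> nat \<Rightarrow> nat \<Rightarrow> bool" where
  "optimal s p y \<longleftrightarrow> p \<le> y \<and> (\<forall>z<Suc (p + s * 2 ^ resol s). p \<le> z \<longrightarrow>
     (2 ^ Suc (level s) - 1) * y + 2 ^ Suc (level s) * bad_count s z \<le>
     (2 ^ Suc (level s) - 1) * z + 2 ^ Suc (level s) * bad_count s y)"

definition grid_pos :: "nat \<Rightarrow> nat" where
  "grid_pos s = rec_nat 0 (\<lambda>k y. LEAST y'. optimal (Suc k) (target k y) y') s"

text \<open>The term \<open>of_nat 0\<close> and the denominator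
  \<open>Suc (2 ^ resol s - 1)\<close> copy the shape that \<open>computable_rat_seq\<close> asks
  for.\<close>

definition pos :: "nat \<Rightarrow> rat" where
  "pos s = (of_nat (grid_pos s) - of_nat 0) / of_nat (Suc (2 ^ resol s - 1))"

lemma optimal_exists: "\<exists>y. optimal s p y"
proof -
  define N where "N = s * 2 ^ resol s"
  define F where "F z = int ((2 ^ Suc (level s) - 1) * z) - int (2 ^ Suc (level s) * bad_count s z)" for z
  have "\<exists>y\<in>{p..p + N}. \<forall>z\<in>{p..p + N}. F y \<le> F z"
    using ex_min_if_finite[of "F ` {p..p + N}"] by (force simp: not_less)
  then obtain y where y: "p \<le> y" "\<And>z. p \<le> z \<Longrightarrow> z \<le> p + N \<Longrightarrow> F y \<le> F z"
    by auto
  have "(2 ^ Suc (level s) - 1) * y + 2 ^ Suc (level s) * bad_count s z \<le>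
     (2 ^ Suc (level s) - 1) * z + 2 ^ Suc (level s) * bad_count s y"
    if "p \<le> z" "z \<le> p + N" for z
    using y(2)[OF that] unfolding F_def by linarith
  then show ?thesis
    using y(1) unfolding optimal_def N_def by (auto simp: less_Suc_eq_le)
qed

lemma level_exists: "\<exists>k. s \<le> k \<or> (\<exists>e\<le>k. newly e k s)"
  by blast

lemma optimal_grid_pos: "optimal (Suc s) (target s (grid_pos s)) (grid_pos (Suc s))"
  unfolding grid_pos_def using LeastI_ex[OF optimal_exists] by simp

section \<open>Computability of the construction\<close>

lemma computable_resol: "computable f \<Longrightarrow> computable (\<lambda>n. resol (f n))"
  unfolding resol_def by (intro computable_intros)

lemma computable_interval_code:
  "computable f \<Longrightarrow> computable g \<Longrightarrow> computable (\<lambda>n. interval_code (f n) (g n))"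
  unfolding interval_code_def by (intro computable_intros computable_universal computable_resol)

lemma decidable_covered:
  assumes "computable f" "computable g" "computable h"
  shows "decidable (\<lambda>n. covered (f n) (g n) (h n))"
  unfolding covered_def code_below_def
  by (intro computable_intros computable_interval_code computable_resol assms
      assms[THEN computable.comp])

lemma decidable_reached:
  assumes "computable f" "computable g" "computable h"
  shows "decidable (\<lambda>n. reached (f n) (g n) (h n))"
  unfolding reached_def covered_count_def
  by (intro computable_intros decidable_covered computable_resol assms assms[THEN computable.comp])

lemma decidable_newly:
  assumes "computable f" "computable g" "computable h"
  shows "decidable (\<lambda>n. newly (f n) (g n) (h n))"
  unfolding newly_def
  by (intro computable_intros decidable_reached assms assms[THEN computable.comp])

lemma computable_level:
  assumes "computable f"
  shows "computable (\<lambda>n. level (f n))"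
  unfolding level_def
  by (intro computable_Least level_exists computable_intros decidable_newly assms
      assms[THEN computable.comp])

lemma computable_bad_count:
  assumes "computable f" "computable g"
  shows "computable (\<lambda>n. bad_count (f n) (g n))"
  unfolding bad_count_def bad_def
  by (intro computable_intros computable_resol decidable_newly decidable_covered assms
      assms[THEN computable.comp])

lemma computable_grid_pos: "computable grid_pos"
proof -
  \<comment> \<open>The constant abstractions make the term an instance of
    \<open>computable_rec\<close>, whose start value and step may depend on
    \<open>n\<close>.\<close>
  have "computable (\<lambda>n. rec_nat ((\<lambda>_. 0) n)
      ((\<lambda>_ k y. LEAST y'. optimal (Suc k) (target k y) y') n) ((\<lambda>n. n) n))"
    by (rule computable_rec; (intro computable_Least optimal_exists)?;
        (unfold optimal_def target_def)?;
        intro computable_intros computable_resol computable_level computable_bad_count)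
  then show ?thesis
    by (simp add: grid_pos_def[abs_def])
qed

lemma computable_pos: "computable_rat_seq pos"
  unfolding computable_rat_seq_def pos_def
  by (intro exI conjI allI; (rule refl)?; intro computable_intros computable_resol computable_grid_pos)

section \<open>Density of the avoided set\<close>

definition weight :: "nat \<Rightarrow> real" where
  "weight k = 1 / 2 ^ resol k"

text \<open>The form \<open>y - (- real u)\<close> makes this an instance of
  \<open>measure_grid_set\<close>.\<close>

definition region :: "nat \<Rightarrow> nat \<Rightarrow> real set" where
  "region e u =
    {y. - real u \<le> y \<and> y < real u \<and> covered e u (nat \<lfloor>(y - (- real u)) * 2 ^ resol u\<rfloor>)}"

definition shadow :: "nat \<Rightarrow> real set" where
  "shadow s = {y. \<exists>u\<le>s. \<exists>k<u. \<exists>e\<le>k. newly e k u \<and> y \<in> region e u}"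

lemma resol_mono: "a \<le> b \<Longrightarrow> resol a \<le> resol b"
  by (simp add: resol_def mult_mono)

lemma weight_pos: "0 < weight k"
  by (simp add: weight_def)

lemma weight_antimono: "a \<le> b \<Longrightarrow> weight b \<le> weight a"
  by (simp add: weight_def resol_mono frac_le)

lemma code_below_iff: "code_below t r u j \<longleftrightarrow> rat_of_code t < real j / 2 ^ r - real u"
proof -
  define a b c where "a = fst (prod_decode t)" and "b = fst (prod_decode (snd (prod_decode t)))"
    and "c = Suc (snd (prod_decode (snd (prod_decode t))))"
  have c: "0 < real c"
    by (simp add: c_def)
  have "code_below t r u j \<longleftrightarrow> real (a * 2 ^ r + u * 2 ^ r * c) < real (j * c + b * 2 ^ r)"
    unfolding code_below_def a_def b_def c_def of_nat_less_iff ..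
  also have "\<dots> \<longleftrightarrow> (real a - real b) / real c < real j / 2 ^ r - real u"
    using c by (simp add: field_simps)
  finally show ?thesis
    unfolding rat_of_code_def a_def b_def c_def .
qed

text \<open>The offset \<open>u\<close> is a whole number of cells, so the cells of all stages
  belong to dyadic grids through 0 and can be compared.\<close>

lemma region_iff:
  "y \<in> region e u \<longleftrightarrow> - real u \<le> y \<and> y < real u \<and> (\<exists>q<u. interval_code e q \<noteq> 0 \<and>
     lower e q < of_int \<lfloor>y * 2 ^ resol u\<rfloor> / 2 ^ resol u \<and>
     (of_int \<lfloor>y * 2 ^ resol u\<rfloor> + 1) / 2 ^ resol u \<le> upper e q)"
proof (cases "- real u \<le> y")
  case True
  have "(y - (- real u)) * 2 ^ resol u = y * 2 ^ resol u + of_int (int u * 2 ^ resol u)"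
    by (simp add: algebra_simps)
  then have "\<lfloor>(y - (- real u)) * 2 ^ resol u\<rfloor> = \<lfloor>y * 2 ^ resol u\<rfloor> + int u * 2 ^ resol u"
    by (metis floor_add_int)
  moreover have "0 \<le> \<lfloor>(y - (- real u)) * 2 ^ resol u\<rfloor>"
    using True by simp
  ultimately have "real (nat \<lfloor>(y - (- real u)) * 2 ^ resol u\<rfloor>) =
      of_int \<lfloor>y * 2 ^ resol u\<rfloor> + real u * 2 ^ resol u"
    by simp
  then have *: "real (nat \<lfloor>(y - (- real u)) * 2 ^ resol u\<rfloor>) / 2 ^ resol u - real u =
      of_int \<lfloor>y * 2 ^ resol u\<rfloor> / 2 ^ resol u"
    "real (Suc (nat \<lfloor>(y - (- real u)) * 2 ^ resol u\<rfloor>)) / 2 ^ resol u - real u =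
      (of_int \<lfloor>y * 2 ^ resol u\<rfloor> + 1) / 2 ^ resol u"
    by (simp_all add: field_simps)
  show ?thesis
    unfolding region_def covered_def code_below_iff mem_Collect_eq * lower_def upper_def not_less
    by blast
qed (simp add: region_def)

lemma floor_refine:
  fixes y :: real
  assumes "r \<le> r'"
  shows "of_int \<lfloor>y * 2 ^ r\<rfloor> / 2 ^ r \<le> of_int \<lfloor>y * 2 ^ r'\<rfloor> / (2 ^ r' :: real)"
    and "(of_int \<lfloor>y * 2 ^ r'\<rfloor> + 1) / 2 ^ r' \<le> (of_int \<lfloor>y * 2 ^ r\<rfloor> + 1) / (2 ^ r :: real)"
proof -
  obtain d where d: "r' = r + d"
    using assms le_Suc_ex by blast
  have y: "y * 2 ^ r' = y * 2 ^ r * 2 ^ d"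
    by (simp add: d power_add)
  have "of_int (\<lfloor>y * 2 ^ r\<rfloor> * 2 ^ d) \<le> y * 2 ^ r'"
    unfolding y by (simp add: mult_right_mono)
  then have "\<lfloor>y * 2 ^ r\<rfloor> * 2 ^ d \<le> \<lfloor>y * 2 ^ r'\<rfloor>"
    by (simp only: le_floor_iff)
  then have "of_int \<lfloor>y * 2 ^ r\<rfloor> * 2 ^ d \<le> (of_int \<lfloor>y * 2 ^ r'\<rfloor> :: real)"
    by (metis of_int_le_iff of_int_mult of_int_numeral of_int_power)
  then show "of_int \<lfloor>y * 2 ^ r\<rfloor> / 2 ^ r \<le> of_int \<lfloor>y * 2 ^ r'\<rfloor> / (2 ^ r' :: real)"
    by (simp add: d power_add field_simps)
  have "y * 2 ^ r < of_int (\<lfloor>y * 2 ^ r\<rfloor> + 1)"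
    by linarith
  then have "y * 2 ^ r' < of_int ((\<lfloor>y * 2 ^ r\<rfloor> + 1) * 2 ^ d)"
    unfolding y by simp
  then have "\<lfloor>y * 2 ^ r'\<rfloor> < (\<lfloor>y * 2 ^ r\<rfloor> + 1) * 2 ^ d"
    by (simp only: floor_less_iff)
  then have "\<lfloor>y * 2 ^ r'\<rfloor> + 1 \<le> (\<lfloor>y * 2 ^ r\<rfloor> + 1) * 2 ^ d"
    by linarith
  then have "of_int \<lfloor>y * 2 ^ r'\<rfloor> + 1 \<le> (of_int \<lfloor>y * 2 ^ r\<rfloor> + 1) * (2 ^ d :: real)"
    by (metis (mono_tags) of_int_1 of_int_add of_int_le_iff of_int_mult of_int_numeral of_int_power)
  then have "(of_int \<lfloor>y * 2 ^ r'\<rfloor> + 1) / (2 ^ r * 2 ^ d) \<le>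
      (of_int \<lfloor>y * 2 ^ r\<rfloor> + 1) * 2 ^ d / (2 ^ r * 2 ^ d :: real)"
    by (rule divide_right_mono) simp
  then show "(of_int \<lfloor>y * 2 ^ r'\<rfloor> + 1) / 2 ^ r' \<le> (of_int \<lfloor>y * 2 ^ r\<rfloor> + 1) / (2 ^ r :: real)"
    by (simp add: d power_add)
qed

text \<open>The cell of \<open>y\<close> at the later stage lies inside its cell at the earlier one,
  so the same interval still contains it.\<close>

lemma region_mono:
  assumes "u \<le> u'"
  shows "region e u \<subseteq> region e u'"
proof
  fix y assume y: "y \<in> region e u"
  note refine = floor_refine[OF resol_mono[OF assms], of y]
  from y obtain q where q: "q < u" "interval_code e q \<noteq> 0"
    "lower e q < of_int \<lfloor>y * 2 ^ resol u\<rfloor> / 2 ^ resol u"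
    "(of_int \<lfloor>y * 2 ^ resol u\<rfloor> + 1) / 2 ^ resol u \<le> upper e q"
    unfolding region_iff by blast
  have "q < u'" "lower e q < of_int \<lfloor>y * 2 ^ resol u'\<rfloor> / 2 ^ resol u'"
    "(of_int \<lfloor>y * 2 ^ resol u'\<rfloor> + 1) / 2 ^ resol u' \<le> upper e q"
    using q refine assms by linarith+
  moreover have "- real u' \<le> y" "y < real u'"
    using y assms unfolding region_iff by linarith+
  ultimately show "y \<in> region e u'"
    unfolding region_iff using q(2) by blast
qed

section \<open>Measures of unions of grid cells\<close>

lemma Ico_fmeasurable: "{a..<b} \<in> fmeasurable lborel" for a b :: real
  by (cases "a \<le> b") (auto intro: fmeasurableI)

lemma measure_disjoint_Un:
  assumes "A \<in> fmeasurable M" "B \<in> fmeasurable M" "A \<inter> B = {}"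
  shows "measure M (A \<union> B) = measure M A + measure M B"
proof -
  have "B - A = B" using assms(3) by blast
  then show ?thesis using measure_Un2[OF assms(1,2)] by simp
qed

text \<open>The offset \<open>c\<close> lets one induction over the cells serve both grids: from
  \<open>- real u\<close> for regions and from 0 for the avoided set.\<close>

lemma measure_grid_set:
  fixes c N :: real and P :: "nat \<Rightarrow> bool"
  assumes "0 < N"
  defines "D \<equiv> \<lambda>z. {y. c \<le> y \<and> y < c + real z / N \<and> P (nat \<lfloor>(y - c) * N\<rfloor>)}"
  shows "D z \<in> fmeasurable lborel \<and> measure lborel (D z) = real (\<Sum>i<z. of_bool (P i)) / N"
proof (induction z)
  case 0
  have "D 0 = {}"
    unfolding D_def by auto
  then show ?case by simp
next
  case (Suc z)
  define I where "I = {c + real z / N..<c + real (Suc z) / N}"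
  have floor_I: "nat \<lfloor>(y - c) * N\<rfloor> = z \<longleftrightarrow> y \<in> I" if "c \<le> y" for y
  proof -
    have "nat \<lfloor>(y - c) * N\<rfloor> = z \<longleftrightarrow> \<lfloor>(y - c) * N\<rfloor> = int z"
      using that \<open>0 < N\<close> by (auto simp: nat_eq_iff)
    also have "\<dots> \<longleftrightarrow> y \<in> I"
      unfolding floor_eq_iff I_def using \<open>0 < N\<close> by (auto simp: field_simps)
    finally show ?thesis .
  qed
  have "y < c + real (Suc z) / N \<longleftrightarrow> y < c + real z / N \<or> y \<in> I" for y
    using \<open>0 < N\<close> unfolding I_def by (auto simp: field_simps)
  moreover have "c \<le> y" if "y \<in> I" for y
    using that \<open>0 < N\<close> unfolding I_def by (auto intro: order_trans[rotated])
  ultimately have D: "D (Suc z) = D z \<union> (if P z then I else {})"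
    unfolding D_def using floor_I by auto
  have I: "I \<in> fmeasurable lborel" "measure lborel I = 1 / N"
    unfolding I_def using \<open>0 < N\<close> Ico_fmeasurable by (blast, simp add: field_simps)
  have "D z \<inter> I = {}"
    unfolding D_def I_def by auto
  then show ?case
    using Suc I \<open>0 < N\<close>
    by (auto simp: D measure_disjoint_Un add_divide_distrib)
qed

lemma region_measure:
  "region e u \<in> fmeasurable lborel"
  "measure lborel (region e u) = real (covered_count e u) / 2 ^ resol u"
proof -
  have "region e u = {y. - real u \<le> y \<and> y < - real u + real (2 * u * 2 ^ resol u) / 2 ^ resol u \<and>
      covered e u (nat \<lfloor>(y - (- real u)) * 2 ^ resol u\<rfloor>)}"
    unfolding region_def by auto
  then show "region e u \<in> fmeasurable lborel"
    "measure lborel (region e u) = real (covered_count e u) / 2 ^ resol u"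
    using measure_grid_set[of "2 ^ resol u" "- real u" "2 * u * 2 ^ resol u" "covered e u"]
    by (simp_all add: covered_count_def)
qed

lemma shadow_iff_bad:
  assumes "0 \<le> y"
  shows "y \<in> shadow s \<longleftrightarrow> bad s (nat \<lfloor>y * 2 ^ resol s\<rfloor>)"
proof -
  have eq: "nat \<lfloor>(y - (- real u)) * 2 ^ resol u\<rfloor> =
      nat \<lfloor>y * 2 ^ resol s\<rfloor> div 2 ^ (resol s - resol u) + u * 2 ^ resol u" if "u \<le> s" for u
  proof -
    have "y * 2 ^ resol s / real_of_int (2 ^ (resol s - resol u)) = y * 2 ^ resol u"
      using resol_mono[OF that] le_Suc_ex by (force simp: power_add)
    then have "\<lfloor>y * 2 ^ resol u\<rfloor> = \<lfloor>y * 2 ^ resol s\<rfloor> div 2 ^ (resol s - resol u)"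
      using floor_divide_real_eq_div[of "2 ^ (resol s - resol u)" "y * 2 ^ resol s"] by simp
    then have "nat \<lfloor>y * 2 ^ resol u\<rfloor> = nat \<lfloor>y * 2 ^ resol s\<rfloor> div 2 ^ (resol s - resol u)"
      using assms by (simp add: nat_div_distrib nat_power_eq)
    moreover have "(y - (- real u)) * 2 ^ resol u = y * 2 ^ resol u + of_int (int (u * 2 ^ resol u))"
      by (simp add: algebra_simps)
    then have "\<lfloor>(y - (- real u)) * 2 ^ resol u\<rfloor> = \<lfloor>y * 2 ^ resol u\<rfloor> + int (u * 2 ^ resol u)"
      by (metis floor_add_int)
    ultimately show ?thesis
      using assms by (simp add: nat_add_distrib nat_mult_distrib nat_power_eq)
  qed
  have bound: "nat \<lfloor>(y - (- real u)) * 2 ^ resol u\<rfloor> < 2 * u * 2 ^ resol u \<longleftrightarrow> y < real u" for u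
  proof -
    have "nat \<lfloor>(y - (- real u)) * 2 ^ resol u\<rfloor> < 2 * u * 2 ^ resol u \<longleftrightarrow>
        (y - (- real u)) * 2 ^ resol u < real (2 * u * 2 ^ resol u)"
      using assms by (simp add: nat_less_iff floor_less_iff)
    also have "\<dots> \<longleftrightarrow> (y - (- real u)) < 2 * real u"
      by simp
    finally show ?thesis by auto
  qed
  have "y \<in> region e u \<longleftrightarrow>
      nat \<lfloor>y * 2 ^ resol s\<rfloor> div 2 ^ (resol s - resol u) + u * 2 ^ resol u < 2 * u * 2 ^ resol u \<and>
      covered e u (nat \<lfloor>y * 2 ^ resol s\<rfloor> div 2 ^ (resol s - resol u) + u * 2 ^ resol u)"
    if "u \<le> s" for e u
    unfolding eq[OF that, symmetric] bound region_def using assms by auto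
  then show ?thesis
    unfolding shadow_def bad_def mem_Collect_eq by (simp only: cong: conj_cong)
qed

lemma shadow_fmeasurable: "shadow s \<in> fmeasurable lborel"
proof -
  have "shadow s = (\<Union>u\<in>{..s}. \<Union>k\<in>{..<u}. \<Union>e\<in>{e. e \<le> k \<and> newly e k u}. region e u)"
    unfolding shadow_def by auto
  then show ?thesis
    by (simp only:) (intro fmeasurable.finite_UN region_measure(1); simp)
qed

definition mass :: "nat \<Rightarrow> real \<Rightarrow> real \<Rightarrow> real" where
  "mass s a b = measure lborel (shadow s \<inter> {a..<b})"

lemma shadow_Int_fmeasurable: "shadow s \<inter> {a..<b} \<in> fmeasurable lborel"
  by (intro fmeasurable.Int shadow_fmeasurable Ico_fmeasurable)

lemma mass_nonneg: "0 \<le> mass s a b"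
  by (simp add: mass_def)

lemma mass_split: "a \<le> b \<Longrightarrow> b \<le> c \<Longrightarrow> mass s a c = mass s a b + mass s b c"
proof -
  assume "a \<le> b" "b \<le> c"
  then have "shadow s \<inter> {a..<c} = (shadow s \<inter> {a..<b}) \<union> (shadow s \<inter> {b..<c})"
    by auto
  moreover have "(shadow s \<inter> {a..<b}) \<inter> (shadow s \<inter> {b..<c}) = {}"
    by auto
  ultimately show ?thesis
    unfolding mass_def using shadow_Int_fmeasurable[of s a b] shadow_Int_fmeasurable[of s b c]
    by (simp add: measure_disjoint_Un)
qed

lemma mass_grid: "mass s 0 (real z / 2 ^ resol s) = real (bad_count s z) / 2 ^ resol s"
proof -
  have "shadow s \<inter> {0..<real z / 2 ^ resol s} =
      {y. 0 \<le> y \<and> y < 0 + real z / 2 ^ resol s \<and> bad s (nat \<lfloor>(y - 0) * 2 ^ resol s\<rfloor>)}"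
    using shadow_iff_bad by auto
  then show ?thesis
    using measure_grid_set[of "2 ^ resol s" 0 z "bad s"] by (simp add: mass_def bad_count_def)
qed

lemma mass_le_length: "a \<le> b \<Longrightarrow> mass s a b \<le> b - a"
  unfolding mass_def
  using measure_mono_fmeasurable[of "shadow s \<inter> {a..<b}" "{a..<b}" lborel]
    fmeasurableD[OF shadow_Int_fmeasurable[of s a b]] Ico_fmeasurable[of a b] by simp

lemma level_le: "level s \<le> s"
  unfolding level_def by (rule Least_le) simp

lemma weight_grid: "k \<le> s \<Longrightarrow> real (2 ^ (resol s - resol k)) / 2 ^ resol s = weight k"
  using resol_mono[of k s] le_Suc_ex by (force simp: weight_def power_add)

lemma reached_iff:
  "reached e k u \<longleftrightarrow> e \<le> k \<and> k < u \<and> measure lborel (region e u) \<le> weight e \<and>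
     weight e \<le> measure lborel (region e u) + weight (Suc k)"
proof (cases "e \<le> k \<and> k < u")
  case True
  have "measure lborel (region e u) \<le> weight e \<longleftrightarrow>
      real (covered_count e u) \<le> real (2 ^ (resol u - resol e))"
    unfolding region_measure(2) using True by (simp add: weight_grid[of e u, symmetric] divide_le_cancel)
  moreover have "weight e \<le> measure lborel (region e u) + weight (Suc k) \<longleftrightarrow>
      real (2 ^ (resol u - resol e)) \<le> real (covered_count e u) + real (2 ^ (resol u - resol (Suc k)))"
  proof -
    have "weight e = real (2 ^ (resol u - resol e)) / 2 ^ resol u"
      "weight (Suc k) = real (2 ^ (resol u - resol (Suc k))) / 2 ^ resol u"
      using weight_grid[of e u] weight_grid[of "Suc k" u] True by (metis Suc_leI le_trans less_imp_le)+
    then show ?thesis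
      unfolding region_measure(2)
      by (simp only: add_divide_distrib[symmetric]) (simp add: divide_le_cancel)
  qed
  ultimately show ?thesis
    unfolding reached_def using True of_nat_le_iff[where 'a = real] by (metis of_nat_add)
qed (auto simp: reached_def)

section \<open>Consequences of minimality\<close>

definition slope :: "nat \<Rightarrow> real" where
  "slope k = 1 - 1 / 2 ^ Suc k"

lemma slope_bounds: "0 \<le> slope k" "slope k < 1"
  by (auto simp: slope_def field_simps) (metis one_le_power one_le_numeral mult_2 add_increasing2 zero_le_numeral zero_le_power)

lemma bad_count_beyond:
  assumes "s * 2 ^ resol s \<le> z" "z \<le> z'"
  shows "bad_count s z' = bad_count s z"
proof -
  have "\<not> bad s i" if "s * 2 ^ resol s \<le> i" for i
  proof -
    have "real i / 2 ^ resol s \<notin> shadow s"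
    proof
      assume "real i / 2 ^ resol s \<in> shadow s"
      then obtain u where "u \<le> s" "real i / 2 ^ resol s < real u"
        unfolding shadow_def region_def by auto
      then have "real i / 2 ^ resol s < real s" by simp
      then have "real i < real (s * 2 ^ resol s)" by (simp add: field_simps)
      then show False using that by linarith
    qed
    then show ?thesis
      using shadow_iff_bad[of "real i / 2 ^ resol s" s] by simp
  qed
  then show ?thesis
    unfolding bad_count_def using assms
    by (intro sum.mono_neutral_right) auto
qed

lemma optimal_grid:
  assumes "optimal s p y" "p \<le> z"
  shows "slope (level s) * real y - real (bad_count s y) \<le>
    slope (level s) * real z - real (bad_count s z)"
proof -
  have grid: "slope (level s) * real y - real (bad_count s y) \<le>
    slope (level s) * real z - real (bad_count s z)" if "p \<le> z" "z \<le> p + s * 2 ^ resol s" for z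
  proof -
    define M where "M = (2::nat) ^ Suc (level s)"
    have M: "1 \<le> M" by (simp add: M_def)
    have "(M - 1) * y + M * bad_count s z \<le> (M - 1) * z + M * bad_count s y"
      using assms(1) that unfolding optimal_def M_def by auto
    then have "real ((M - 1) * y + M * bad_count s z) \<le> real ((M - 1) * z + M * bad_count s y)"
      by (simp only: of_nat_le_iff)
    then have "(real M - 1) * real y + real M * real (bad_count s z) \<le>
        (real M - 1) * real z + real M * real (bad_count s y)"
      using M by (simp add: of_nat_diff)
    moreover have "real M * slope (level s) = real M - 1"
      unfolding slope_def M_def by (simp add: field_simps)
    ultimately have "real M * (slope (level s) * real y - real (bad_count s y)) \<le>
        real M * (slope (level s) * real z - real (bad_count s z))"
      using M by (simp add: right_diff_distrib mult.assoc[symmetric])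
    then show ?thesis
      using M by simp
  qed
  show ?thesis
  proof (cases "z \<le> p + s * 2 ^ resol s")
    \<comment> \<open>Past the last bad cell the minimised expression does not decrease, so the end
      of the searched range is at least as good as \<open>z\<close>.\<close>
    case False
    then have "bad_count s z = bad_count s (p + s * 2 ^ resol s)"
      by (intro bad_count_beyond) auto
    moreover have "slope (level s) * real (p + s * 2 ^ resol s) \<le> slope (level s) * real z"
      using False slope_bounds(1) by (intro mult_left_mono) linarith+
    ultimately show ?thesis
      using grid[of "p + s * 2 ^ resol s"] by simp
  qed (use grid assms(2) in blast)
qed

text \<open>Within one cell the expression is linear: of slope a - 1 < 0 on a bad cell, where the
  right end point is better than \<open>z\<close>, and of slope a >= 0 on a clean one, where the
  left end point is at least as good. So minimality on the grid implies minimality among the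
  reals.\<close>

lemma optimal_real:
  assumes "optimal s p y" "real p / 2 ^ resol s \<le> z"
  shows "slope (level s) * (real y / 2 ^ resol s) - mass s 0 (real y / 2 ^ resol s) \<le>
    slope (level s) * z - mass s 0 z"
proof -
  define N :: real where "N = 2 ^ resol s"
  define a where "a = slope (level s)"
  define Z where "Z = nat \<lfloor>z * N\<rfloor>"
  have N: "0 < N" by (simp add: N_def)
  have a: "0 \<le> a" "a < 1" unfolding a_def by (rule slope_bounds)+
  have pz: "real p \<le> z * N"
    using assms(2) N by (simp add: N_def field_simps)
  have z0: "0 \<le> z * N" using pz by (rule order_trans[rotated]) simp
  have Z: "real Z \<le> z * N" "z * N < real Z + 1"
    unfolding Z_def using z0 by linarith+
  have pZ: "p \<le> Z"
    unfolding Z_def using pz by linarith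
  have ZN: "real Z / N \<le> z" "0 \<le> real Z / N" "z < real (Suc Z) / N"
    using Z N by (auto simp: field_simps)
  have split: "mass s 0 z = real (bad_count s Z) / N + mass s (real Z / N) z"
    using mass_split[of 0 "real Z / N" z s] ZN mass_grid[of s Z] by (simp add: N_def)
  have opt: "a * real y - real (bad_count s y) \<le> a * real Z' - real (bad_count s Z')" if "p \<le> Z'" for Z'
    unfolding a_def by (rule optimal_grid[OF assms(1) that])
  have "a * real y - real (bad_count s y) \<le> a * (z * N) - mass s 0 z * N"
  proof (cases "bad s Z")
    case True
    have "mass s (real Z / N) z * N \<le> z * N - real Z"
      using mass_le_length[OF ZN(1), of s] N by (simp add: field_simps)
    then have "mass s 0 z * N \<le> real (bad_count s Z) + (z * N - real Z)"
      using N by (simp add: split distrib_right)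
    moreover have "real (bad_count s (Suc Z)) = real (bad_count s Z) + 1"
      using True by (simp add: bad_count_def)
    moreover have "(1 - a) * (z * N) \<le> (1 - a) * (real Z + 1)"
      using a Z by (intro mult_left_mono) auto
    ultimately show ?thesis
      using opt[of "Suc Z"] pZ by (simp add: algebra_simps)
  next
    case False
    have "nat \<lfloor>y * N\<rfloor> = Z" if "real Z / N \<le> y" "y < z" for y
    proof -
      have "real Z \<le> y * N" "y * N < z * N"
        using that N by (simp_all add: pos_divide_le_eq)
      then show ?thesis using Z(2) by linarith
    qed
    then have "y \<notin> shadow s" if "real Z / N \<le> y" "y < z" for y
      using shadow_iff_bad[of y s] False that ZN(2) by (simp add: N_def)
    then have "shadow s \<inter> {real Z / N..<z} = {}"
      by auto
    then have "mass s (real Z / N) z = 0"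
      unfolding mass_def by simp
    then have "mass s 0 z * N = real (bad_count s Z)"
      using N by (simp add: split)
    moreover have "a * real Z \<le> a * (z * N)"
      using a Z by (intro mult_left_mono)
    ultimately show ?thesis
      using opt[of Z] pZ by linarith
  qed
  then show ?thesis
    using N mass_grid[of s y] unfolding a_def N_def[symmetric]
    by (simp add: field_simps)
qed

definition rpos :: "nat \<Rightarrow> real" where
  "rpos s = real (grid_pos s) / 2 ^ resol s"

lemma rpos_nonneg: "0 \<le> rpos s"
  by (simp add: rpos_def)

lemma target_real:
  "real (target s (grid_pos s)) / 2 ^ resol (Suc s) = rpos s + weight (level (Suc s))"
proof -
  have "real (grid_pos s * 2 ^ (resol (Suc s) - resol s)) / 2 ^ resol (Suc s) = rpos s"
    using weight_grid[of s "Suc s"] by (simp add: rpos_def weight_def field_simps)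
  then show ?thesis
    using weight_grid[OF level_le[of "Suc s"]]
    unfolding target_def of_nat_add add_divide_distrib by simp
qed

lemma rpos_step: "rpos s + weight (level (Suc s)) \<le> rpos (Suc s)"
proof -
  have "target s (grid_pos s) \<le> grid_pos (Suc s)"
    using optimal_grid_pos[of s] unfolding optimal_def by blast
  then have "real (target s (grid_pos s)) / 2 ^ resol (Suc s) \<le> rpos (Suc s)"
    unfolding rpos_def by (intro divide_right_mono) auto
  then show ?thesis
    by (simp only: target_real)
qed

lemma rpos_optimal:
  assumes "rpos s + weight (level (Suc s)) \<le> z"
  shows "slope (level (Suc s)) * rpos (Suc s) - mass (Suc s) 0 (rpos (Suc s)) \<le>
    slope (level (Suc s)) * z - mass (Suc s) 0 z"
  using optimal_real[OF optimal_grid_pos[of s], of z] assms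
  unfolding target_real rpos_def[symmetric] by blast

text \<open>The minimiser is compared with points to its right. Stage 0 is excluded since its
  position does not come from a minimisation.\<close>

lemma mass_right:
  assumes "0 < s" "rpos s \<le> z"
  shows "mass s (rpos s) z \<le> slope (level s) * (z - rpos s)"
proof -
  obtain s' where s: "s = Suc s'"
    using assms(1) gr0_implies_Suc by blast
  show ?thesis
    using rpos_optimal[of s' z] rpos_step[of s'] assms(2) mass_split[OF rpos_nonneg assms(2), of s]
    by (simp add: s algebra_simps)
qed

text \<open>The minimiser is compared with the point where the search began: beyond the forced jump,
  the approximation moves only across an interval where the avoided set is dense.\<close>

lemma mass_left:
  "slope (level (Suc s)) * (rpos (Suc s) - (rpos s + weight (level (Suc s)))) \<le>
    mass (Suc s) (rpos s + weight (level (Suc s))) (rpos (Suc s))"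
proof -
  have "0 \<le> rpos s + weight (level (Suc s))"
    using rpos_nonneg weight_pos by (simp add: add_nonneg_nonneg less_imp_le)
  from mass_split[OF this rpos_step, of "Suc s"] show ?thesis
    using rpos_optimal[of s, OF order_refl] by (simp add: algebra_simps)
qed

section \<open>Movement of the approximation\<close>

lemma newly_unique: "newly e k s \<Longrightarrow> newly e k s' \<Longrightarrow> s = s'"
  unfolding newly_def by (metis linorder_neqE_nat)

lemma reached_newly: "reached e k u \<Longrightarrow> \<exists>u'\<le>u. newly e k u'"
  unfolding newly_def
  by (metis (mono_tags, lifting) LeastI Least_le not_less_Least)

lemma reached_le:
  assumes "reached e k' u" "k \<le> k'" "e \<le> k"
  shows "reached e k u"
  using assms weight_antimono[of "Suc k" "Suc k'"] unfolding reached_iff by auto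

lemma level_cases: "level s = s \<or> (\<exists>e\<le>level s. newly e (level s) s)"
  using LeastI_ex[OF level_exists[of s]] level_le[of s] unfolding level_def[symmetric] by auto

lemma level_newly: "newly e k s \<Longrightarrow> level s \<le> k"
  unfolding level_def by (rule Least_le) (auto simp: newly_def reached_def)

text \<open>A stage of level \<open>k\<close> is either \<open>k\<close> itself, by the default
  value, or the unique stage triggered by \<open>k\<close> and one of the \<open>k + 1\<close>
  programs up to \<open>k\<close>.\<close>

lemma level_card: "finite {s. level s = k} \<and> card {s. level s = k} \<le> k + 2"
proof -
  have fin: "finite {s. newly e k s} \<and> card {s. newly e k s} \<le> 1" for e
  proof (cases "\<exists>s. newly e k s")
    case True
    then obtain s where "{s. newly e k s} = {s}"
      using newly_unique by blast
    then show ?thesis by simp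
  qed simp
  have "card (\<Union>e\<le>k. {s. newly e k s}) \<le> (\<Sum>e\<le>k. card {s. newly e k s})"
    by (rule card_UN_le) simp
  also have "\<dots> \<le> (\<Sum>e\<le>k. 1)"
    using fin by (intro sum_mono) blast
  finally have card: "card (\<Union>e\<le>k. {s. newly e k s}) \<le> k + 1"
    by simp
  have sub: "{s. level s = k} \<subseteq> insert k (\<Union>e\<le>k. {s. newly e k s})"
  proof
    fix s assume "s \<in> {s. level s = k}"
    then show "s \<in> insert k (\<Union>e\<le>k. {s. newly e k s})"
      using level_cases[of s] by auto
  qed
  have fin': "finite (insert k (\<Union>e\<le>k. {s. newly e k s}))"
    using fin by blast
  have "card (insert k (\<Union>e\<le>k. {s. newly e k s})) \<le> k + 2"
    using card card_insert_le_m1[of "k + 2" "\<Union>e\<le>k. {s. newly e k s}" k] by simp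
  then show ?thesis
    using card_mono[OF fin' sub] finite_subset[OF sub fin'] by linarith
qed

text \<open>Only finitely many stages have level at most \<open>k\<close>, and stage
  \<open>k\<close> is one of them.\<close>

lemma last_stage: "\<exists>t\<ge>k. level t \<le> k \<and> (\<forall>s>t. k < level s)"
proof -
  have "{s. level s \<le> k} = (\<Union>j\<le>k. {s. level s = j})"
    by auto
  then have fin: "finite {s. level s \<le> k}"
    using level_card by simp
  have k: "k \<in> {s. level s \<le> k}"
    using level_le by simp
  define t where "t = Max {s. level s \<le> k}"
  have "k \<le> t" "level t \<le> k"
    using Max_ge[OF fin k] Max_in[OF fin] k unfolding t_def by auto
  moreover have "k < level s" if "t < s" for s
    using that Max_ge[OF fin, of s] unfolding t_def by (meson leD leI mem_Collect_eq)
  ultimately show ?thesis by blast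
qed

section \<open>Growth of the avoided set, forced jumps and total movement\<close>

definition released :: "nat \<Rightarrow> nat \<Rightarrow> real set" where
  "released e s = {y. \<exists>u\<le>s. \<exists>k<u. e \<le> k \<and> newly e k u \<and> y \<in> region e u}"

text \<open>The regions of one program are nested, so all its releases up to \<open>s\<close> amount
  to the latest one.\<close>

lemma released_cases:
  "released e s = {} \<or> (\<exists>u\<le>s. \<exists>k. newly e k u \<and> released e s = region e u)"
proof (cases "\<exists>u\<le>s. \<exists>k. newly e k u")
  case True
  define V where "V = {u. u \<le> s \<and> (\<exists>k. newly e k u)}"
  have "finite V" "V \<noteq> {}"
    using True unfolding V_def by auto
  then have max: "Max V \<in> V" "\<And>u. u \<in> V \<Longrightarrow> u \<le> Max V"
    by auto
  have "released e s \<subseteq> region e (Max V)"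
    using max(2) region_mono unfolding released_def V_def by blast
  moreover have "region e (Max V) \<subseteq> released e s"
    using max(1) unfolding released_def V_def newly_def reached_def by blast
  ultimately show ?thesis
    using max(1) unfolding V_def by blast
qed (auto simp: released_def)

lemma released_fmeasurable: "released e s \<in> fmeasurable lborel"
  using released_cases[of e s] region_measure(1) by (metis fmeasurable.empty_sets)

lemma region_newly: "newly e k u \<Longrightarrow> u \<le> s \<Longrightarrow> region e u \<subseteq> released e s"
  unfolding released_def newly_def reached_def by blast

lemma released_subset_shadow: "released e s \<subseteq> shadow s"
  unfolding released_def shadow_def by blast

text \<open>If \<open>e \<le> k\<close>, a release after \<open>t\<close> also meets the condition
  for \<open>k\<close>, and the first stage to meet it is at most \<open>t\<close>. So all but
  \<open>weight (Suc k)\<close> of the allowance \<open>weight e\<close> had been released by then.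
  For larger \<open>e\<close> the whole allowance is the bound.\<close>

lemma released_growth:
  assumes "\<And>s. t < s \<Longrightarrow> s \<le> T \<Longrightarrow> k < level s"
  shows "measure lborel (released e T - released e t) \<le> (if e \<le> k then weight (Suc k) else weight e)"
proof (cases "released e T \<subseteq> released e t")
  case True
  then have "released e T - released e t = {}" by blast
  then have "measure lborel (released e T - released e t) = 0" by (simp only: measure_empty)
  then show ?thesis using weight_pos by (simp add: less_imp_le)
next
  case False
  then obtain u k1 where u: "u \<le> T" "newly e k1 u" "released e T = region e u"
    using released_cases[of e T] by blast
  have le: "measure lborel (region e u) \<le> weight e"
    using u(2) unfolding newly_def reached_iff by blast
  have "\<not> u \<le> t"
    using False u(3) region_newly[OF u(2)] by blast
  then have "t < u" by simp
  then have "k < k1"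
    using assms[of u] u(1) level_newly[OF u(2)] by simp
  show ?thesis
  proof (cases "e \<le> k")
    case True
    have "reached e k u"
      using reached_le[of e k1 u k] u(2) \<open>k < k1\<close> True unfolding newly_def by simp
    then obtain v where v: "v \<le> u" "newly e k v"
      using reached_newly by blast
    have "v \<le> t"
      using assms[of v] v(1) u(1) level_newly[OF v(2)] by (meson leD leI le_trans)
    then have "released e T - released e t \<subseteq> region e u - region e v"
      using region_newly[OF v(2)] u(3) by blast
    then have "measure lborel (released e T - released e t) \<le> measure lborel (region e u - region e v)"
      by (intro measure_mono_fmeasurable fmeasurable.Diff released_fmeasurable region_measure(1)
          fmeasurableD)
    also have "\<dots> = measure lborel (region e u) - measure lborel (region e v)"
      by (intro measurable_measure_Diff region_measure(1) fmeasurableD region_mono v(1))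
    also have "\<dots> \<le> weight (Suc k)"
      using le v(2) unfolding newly_def reached_iff by linarith
    finally show ?thesis using True by simp
  next
    case False
    have "measure lborel (released e T - released e t) \<le> measure lborel (region e u)"
      unfolding u(3)
      by (intro measure_mono_fmeasurable fmeasurable.Diff released_fmeasurable region_measure(1)
          fmeasurableD) blast
    then show ?thesis using le False by simp
  qed
qed

lemma shadow_growth:
  assumes "\<And>s. t < s \<Longrightarrow> s \<le> T \<Longrightarrow> k < level s"
  shows "measure lborel (shadow T - shadow t) \<le>
    real (k + 1) * weight (Suc k) + (\<Sum>e\<in>{k<..T}. weight e)"
proof -
  have "shadow T - shadow t \<subseteq> (\<Union>e\<le>T. released e T - released e t)"
  proof
    fix y assume y: "y \<in> shadow T - shadow t"
    then obtain u j e where u: "u \<le> T" "j < u" "e \<le> j" "newly e j u" "y \<in> region e u"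
      unfolding shadow_def by blast
    then have "y \<in> released e T"
      using region_newly by blast
    moreover have "y \<notin> released e t"
      using y released_subset_shadow by blast
    moreover have "e \<le> T"
      using u by linarith
    ultimately show "y \<in> (\<Union>e\<le>T. released e T - released e t)"
      by blast
  qed
  then have "measure lborel (shadow T - shadow t) \<le>
      measure lborel (\<Union>e\<le>T. released e T - released e t)"
    by (intro measure_mono_fmeasurable fmeasurable.finite_UN fmeasurable.Diff fmeasurableD
        shadow_fmeasurable released_fmeasurable) auto
  also have "\<dots> \<le> (\<Sum>e\<le>T. measure lborel (released e T - released e t))"
    by (intro measure_UNION_le fmeasurableD fmeasurable.Diff released_fmeasurable) simp
  also have "\<dots> \<le> (\<Sum>e\<le>T. if e \<le> k then weight (Suc k) else weight e)"
    using released_growth[OF assms] by (intro sum_mono) blast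
  also have "\<dots> \<le> (\<Sum>e\<in>{..k} \<union> {k<..T}. if e \<le> k then weight (Suc k) else weight e)"
    using weight_pos by (intro sum_mono2) (auto simp: less_imp_le)
  also have "\<dots> = real (k + 1) * weight (Suc k) + (\<Sum>e\<in>{k<..T}. weight e)"
    by (subst sum.union_disjoint) auto
  finally show ?thesis .
qed

text \<open>The stages are grouped by level, and \<open>level_card\<close> bounds the size of each
  group.\<close>

lemma jump_sum:
  assumes "\<And>s. t < s \<Longrightarrow> s \<le> T \<Longrightarrow> k < level s"
  shows "(\<Sum>s\<in>{t<..T}. weight (level s)) \<le> (\<Sum>j\<in>{k<..T}. real (j + 2) * weight j)"
proof -
  have sub: "level ` {t<..T} \<subseteq> {k<..T}"
    using assms le_trans[OF level_le] by (simp add: image_subset_iff)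
  have "(\<Sum>s\<in>{t<..T}. weight (level s)) =
      (\<Sum>j\<in>level ` {t<..T}. \<Sum>s\<in>{s. s \<in> {t<..T} \<and> level s = j}. weight (level s))"
    by (rule sum.image_gen) simp
  also have "\<dots> \<le> (\<Sum>j\<in>level ` {t<..T}. real (j + 2) * weight j)"
  proof (rule sum_mono)
    fix j
    have "card {s. s \<in> {t<..T} \<and> level s = j} \<le> j + 2"
      by (rule order_trans[OF card_mono conjunct2[OF level_card]]) (use level_card in auto)
    then have "real (card {s. s \<in> {t<..T} \<and> level s = j}) * weight j \<le> real (j + 2) * weight j"
      using weight_pos[of j] by (intro mult_right_mono) linarith+
    then show "(\<Sum>s\<in>{s. s \<in> {t<..T} \<and> level s = j}. weight (level s)) \<le> real (j + 2) * weight j"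
      by simp
  qed
  also have "\<dots> \<le> (\<Sum>j\<in>{k<..T}. real (j + 2) * weight j)"
    using sub weight_pos by (intro sum_mono2) (auto simp: less_imp_le)
  finally show ?thesis .
qed

lemma weight_Suc: "weight (Suc k) = weight k / (2 * 2 ^ k * 2 ^ k)"
  by (simp add: weight_def resol_def power_add)

text \<open>From index 1 on the terms at least halve, so the sum is at most twice its first term,
  the one with j = k + 1. The coefficient dominates j + 3, where 1 stems from test \<open>j\<close>
  and j + 2 from the jumps of level \<open>j\<close>.\<close>

lemma weight_tail:
  "(\<Sum>j\<in>{k<..T}. real (2 * j + 3) * weight j) \<le> 2 * real (2 * k + 5) * weight (Suc k)"
proof (cases "k < T")
  case True
  define c where "c j = real (2 * j + 3) * weight j" for j
  have c_pos: "0 \<le> c j" for j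
    using weight_pos[of j] by (simp add: c_def)
  have c_half: "2 * c (Suc j) \<le> c j" if "1 \<le> j" for j
  proof -
    have "(2::real) ^ 1 \<le> 2 ^ j"
      using that by (intro power_increasing) auto
    then have "(2::real) * 2 \<le> 2 ^ j * 2 ^ j"
      by (intro mult_mono) auto
    then have "weight (Suc j) \<le> weight j / 8"
      unfolding weight_Suc using weight_pos[of j] by (intro divide_left_mono) auto
    then have "c (Suc j) \<le> real (2 * j + 5) * (weight j / 8)"
      unfolding c_def by (intro mult_mono) (auto simp: weight_pos less_imp_le)
    moreover have "2 * (real (2 * j + 5) * (weight j / 8)) \<le> c j"
      unfolding c_def using weight_pos[of j] by (simp add: field_simps)
    ultimately show ?thesis by linarith
  qed
  \<comment> \<open>The additional \<open>c T\<close> strengthens the claim so that halving carries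
    the induction.\<close>
  have "(\<Sum>j\<in>{k<..T}. c j) + c T \<le> 2 * c (Suc k)"
    using Suc_leI[OF True]
  proof (induction T rule: dec_induct)
    case base
    have "{k<..Suc k} = {Suc k}" by auto
    then show ?case by simp
  next
    case (step T)
    have "{k<..Suc T} = insert (Suc T) {k<..T}"
      using step by auto
    then show ?case
      using step c_half[of T] by simp
  qed
  then show ?thesis
    using c_pos[of T] by (simp add: c_def algebra_simps)
next
  case False
  then have "{k<..T} = {}" by simp
  then show ?thesis
    using weight_pos[of "Suc k"] by simp
qed

lemma mass_mono_stage:
  assumes "s \<le> s'"
  shows "mass s a b \<le> mass s' a b"
proof -
  have "shadow s \<subseteq> shadow s'"
    using assms unfolding shadow_def by (auto intro: le_trans)
  then show ?thesis
    unfolding mass_def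
    by (intro measure_mono_fmeasurable shadow_Int_fmeasurable fmeasurableD) blast
qed

lemma rpos_mono: "s \<le> s' \<Longrightarrow> rpos s \<le> rpos s'"
  using lift_Suc_mono_le[of rpos] rpos_step weight_pos
  by (meson add_increasing2 le_add_same_cancel1 less_imp_le order_trans)

lemma slope_mono: "j \<le> k \<Longrightarrow> slope j \<le> slope k"
  by (simp add: slope_def frac_le)

text \<open>The inequalities \<open>mass_left\<close> are summed. The avoided set only grows, so
  mass counted at one stage persists; mass on the forced jumps is dropped, and their length is
  subtracted on the left.\<close>

lemma mass_path:
  assumes "t \<le> T" "\<And>s. t < s \<Longrightarrow> s \<le> T \<Longrightarrow> k < level s"
  shows "slope (Suc k) * (rpos T - rpos t - (\<Sum>s\<in>{t<..T}. weight (level s))) \<le>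
    mass T (rpos t) (rpos T)"
  using assms
proof (induction T rule: dec_induct)
  case base
  show ?case by (simp add: mass_nonneg)
next
  case (step T)
  define p where "p = rpos T + weight (level (Suc T))"
  have p: "rpos t \<le> rpos T" "rpos T \<le> p" "p \<le> rpos (Suc T)"
    using rpos_mono step(1) rpos_step weight_pos unfolding p_def by (simp_all add: less_imp_le)
  have ins: "{t<..Suc T} = insert (Suc T) {t<..T}"
    using step(1) by auto
  have "slope (Suc k) * (rpos (Suc T) - rpos t - (\<Sum>s\<in>{t<..Suc T}. weight (level s))) =
      slope (Suc k) * (rpos T - rpos t - (\<Sum>s\<in>{t<..T}. weight (level s))) +
      slope (Suc k) * (rpos (Suc T) - p)"
    by (simp add: ins p_def algebra_simps)
  also have "slope (Suc k) * (rpos (Suc T) - p) \<le> slope (level (Suc T)) * (rpos (Suc T) - p)"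
    using step.prems[of "Suc T"] step(1) p(3) by (intro mult_right_mono slope_mono) auto
  also have "\<dots> \<le> mass (Suc T) p (rpos (Suc T))"
    unfolding p_def by (rule mass_left)
  also have "slope (Suc k) * (rpos T - rpos t - (\<Sum>s\<in>{t<..T}. weight (level s))) \<le>
      mass (Suc T) (rpos t) (rpos T)"
    using step.IH step.prems mass_mono_stage[of T "Suc T" "rpos t" "rpos T"] by fastforce
  also have "mass (Suc T) (rpos t) (rpos T) + mass (Suc T) p (rpos (Suc T)) \<le>
      mass (Suc T) (rpos t) (rpos (Suc T))"
    using mass_split[of "rpos t" "rpos T" "rpos (Suc T)" "Suc T"]
      mass_split[of "rpos T" p "rpos (Suc T)" "Suc T"] mass_nonneg[of "Suc T" "rpos T" p] p
    by linarith
  finally show ?case by simp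
qed

text \<open>This is 2^(k + 2) * 3 * (2 k + 5) * weight (k + 1) / weight k, the factor that arises in
  \<open>movement_bound\<close>.\<close>

definition overshoot :: "nat \<Rightarrow> real" where
  "overshoot k = 6 * real (2 * k + 5) / 2 ^ k"

text \<open>Between \<open>rpos t\<close> and \<open>rpos T\<close> the avoided set of stage
  \<open>t\<close> has density at most \<open>slope k\<close>, and that of stage \<open>T\<close> at
  least \<open>slope (Suc k)\<close> apart from the jumps. The excess was added in between, so the
  difference of the slopes times the distance is at most the added measure plus the jumps.\<close>

lemma movement_bound:
  assumes "0 < t" "t \<le> T" "level t \<le> k" "\<And>s. t < s \<Longrightarrow> k < level s"
  shows "rpos T - rpos t \<le> overshoot k * weight k"
proof -
  define J where "J = (\<Sum>s\<in>{t<..T}. weight (level s))"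
  define m where "m = measure lborel (shadow T - shadow t)"
  define d where "d = rpos T - rpos t"
  have d: "0 \<le> d"
    using rpos_mono[OF assms(2)] by (simp add: d_def)
  have J0: "0 \<le> J"
    unfolding J_def using weight_pos by (intro sum_nonneg) (simp add: less_imp_le)
  have "mass T (rpos t) (rpos T) \<le> measure lborel ((shadow t \<inter> {rpos t..<rpos T}) \<union> (shadow T - shadow t))"
    unfolding mass_def
    by (intro measure_mono_fmeasurable fmeasurable.Un fmeasurable.Diff shadow_Int_fmeasurable
        shadow_fmeasurable fmeasurableD) blast
  also have "\<dots> \<le> mass t (rpos t) (rpos T) + m"
    unfolding mass_def m_def
    by (intro measure_Un_le fmeasurableD fmeasurable.Diff shadow_Int_fmeasurable shadow_fmeasurable)
  also have "mass t (rpos t) (rpos T) \<le> slope (level t) * d"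
    unfolding d_def by (rule mass_right[OF assms(1) rpos_mono[OF assms(2)]])
  also have "\<dots> \<le> slope k * d"
    using d assms(3) by (intro mult_right_mono slope_mono)
  finally have "slope (Suc k) * (d - J) \<le> slope k * d + m"
    using mass_path[OF assms(2), of k] assms(4) unfolding d_def J_def by fastforce
  moreover have "slope (Suc k) * J \<le> 1 * J"
    using slope_bounds[of "Suc k"] J0 by (intro mult_right_mono) auto
  moreover define c :: real where "c = 1 / 2 ^ (k + 2)"
  then have "slope (Suc k) = slope k + c"
    by (simp add: slope_def field_simps)
  ultimately have "c * d \<le> m + J"
    by (simp add: algebra_simps)
  then have "d / 2 ^ (k + 2) \<le> m + J"
    by (simp add: c_def)
  also have "m + J \<le> real (k + 1) * weight (Suc k) + (\<Sum>j\<in>{k<..T}. weight j) +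
      (\<Sum>j\<in>{k<..T}. real (j + 2) * weight j)"
    unfolding m_def J_def using shadow_growth[of t T k] jump_sum[of t T k] assms(4) by fastforce
  also have "\<dots> = real (k + 1) * weight (Suc k) + (\<Sum>j\<in>{k<..T}. real (j + 3) * weight j)"
    by (simp add: sum.distrib[symmetric] algebra_simps)
  also have "(\<Sum>j\<in>{k<..T}. real (j + 3) * weight j) \<le> (\<Sum>j\<in>{k<..T}. real (2 * j + 3) * weight j)"
    using weight_pos by (intro sum_mono mult_right_mono) (auto simp: less_imp_le)
  also have "\<dots> \<le> 2 * real (2 * k + 5) * weight (Suc k)"
    by (rule weight_tail)
  \<comment> \<open>Rounding k + 1 up to 2 k + 5 gives both contributions the same factor, and 1 + 2
    = 3.\<close>
  also have "real (k + 1) * weight (Suc k) \<le> real (2 * k + 5) * weight (Suc k)"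
    using weight_pos[of "Suc k"] by (intro mult_right_mono) auto
  finally have "d / 2 ^ (k + 2) \<le> 3 * real (2 * k + 5) * weight (Suc k)"
    by (simp add: algebra_simps)
  then have "d \<le> 2 ^ (k + 2) * (3 * real (2 * k + 5) * weight (Suc k))"
    by (simp add: pos_divide_le_eq mult.commute)
  also have "\<dots> = overshoot k * weight k"
    unfolding overshoot_def weight_Suc by (simp add: field_simps)
  finally show ?thesis unfolding d_def .
qed

section \<open>Convergence and superspeedability\<close>

lemma rpos_convergent: "convergent rpos"
proof -
  \<comment> \<open>The bound 1 makes \<open>t\<close> positive, as \<open>movement_bound\<close>
    requires.\<close>
  obtain t where t: "1 \<le> t" "level t \<le> 1" "\<forall>s>t. 1 < level s"
    using last_stage[of 1] by blast
  have "rpos s \<le> rpos t + overshoot 1 * weight 1" for s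
    using movement_bound[of t "max s t" 1] t rpos_mono[of s "max s t"] by fastforce
  moreover have "incseq rpos"
    using rpos_mono by (simp add: incseq_def)
  ultimately show ?thesis
    using incseq_convergent[of rpos] unfolding convergent_def by metis
qed

definition limit_pos :: real where
  "limit_pos = lim rpos"

lemma rpos_tendsto: "rpos \<longlonglongrightarrow> limit_pos"
  unfolding limit_pos_def using rpos_convergent by (simp add: convergent_LIMSEQ_iff)

lemma rpos_less_limit: "rpos s < limit_pos"
proof -
  have "rpos s < rpos (Suc s)"
    using rpos_step[of s] weight_pos[of "level (Suc s)"] by linarith
  also have "rpos (Suc s) \<le> limit_pos"
    using incseq_le[OF _ rpos_tendsto] rpos_mono by (simp add: incseq_def)
  finally show ?thesis .
qed

lemma real_pos: "real_of_rat (pos s) = rpos s"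
  by (simp add: pos_def rpos_def of_rat_divide of_rat_power of_rat_of_nat_eq)

lemma left_approximation_pos: "left_approximation pos limit_pos"
  unfolding left_approximation_def real_pos
proof (intro conjI computable_pos rpos_tendsto)
  have "rpos s < rpos (Suc s)" for s
    using rpos_step[of s] weight_pos[of "level (Suc s)"] by linarith
  then show "strict_mono pos"
    unfolding strict_mono_Suc_iff real_pos[symmetric] of_rat_less by blast
qed

text \<open>The quotient is near 1 at the step into the last stage \<open>t = Suc m\<close> of level
  at most \<open>k\<close>: this step is at least \<open>weight k\<close>, and the remaining way at
  most \<open>overshoot k * weight k\<close>. Since \<open>k \<le> t\<close>, such steps occur
  arbitrarily late.\<close>

lemma superspeedable_limit: "superspeedable limit_pos"
proof -
  define f where "f n = (rpos (Suc n) - rpos n) / (limit_pos - rpos n)" for n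
  have f_le: "f n \<le> 1" for n
    unfolding f_def using rpos_less_limit[of n] rpos_less_limit[of "Suc n"] by simp
  have large: "\<exists>m\<ge>n. 1 - overshoot k \<le> f m" if nk: "n < k" for n k
  proof -
    obtain t where t: "k \<le> t" "level t \<le> k" "\<forall>s>t. k < level s"
      using last_stage[of k] by blast
    obtain m where m: "t = Suc m"
      using t(1) nk by (cases t) auto
    have "rpos T \<le> rpos t + overshoot k * weight k" if "t \<le> T" for T
      using movement_bound[of t T k] t that m by simp
    then have "limit_pos \<le> rpos t + overshoot k * weight k"
      by (intro LIMSEQ_le_const2[OF rpos_tendsto]) blast
    moreover have "weight k \<le> limit_pos - rpos m"
      using rpos_step[of m] weight_antimono[OF t(2)] rpos_less_limit[of t] unfolding m by linarith
    then have "overshoot k * weight k \<le> overshoot k * (limit_pos - rpos m)"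
      by (intro mult_left_mono) (auto simp: overshoot_def)
    ultimately have "(1 - overshoot k) * (limit_pos - rpos m) \<le> rpos (Suc m) - rpos m"
      unfolding m by (simp add: algebra_simps)
    then have "1 - overshoot k \<le> f m"
      unfolding f_def using rpos_less_limit[of m] by (simp add: pos_le_divide_eq)
    then show ?thesis
      using t(1) nk m by (intro exI[of _ m]) auto
  qed
  have "overshoot \<longlonglongrightarrow> 0"
    unfolding overshoot_def by real_asymp
  then have "(\<lambda>k. ereal (1 - overshoot k)) \<longlonglongrightarrow> ereal (1 - 0)"
    by (intro tendsto_intros)
  then have lim: "(\<lambda>k. ereal (1 - overshoot k)) \<longlonglongrightarrow> 1"
    by (simp add: one_ereal_def)
  have "1 \<le> (SUP m\<in>{n..}. ereal (f m))" for n
  proof (rule tendsto_upperbound[OF lim])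
    have "ereal (1 - overshoot k) \<le> (SUP m\<in>{n..}. ereal (f m))" if k: "n < k" for k
    proof -
      obtain m where "n \<le> m" "1 - overshoot k \<le> f m"
        using large[OF k] by blast
      then show ?thesis
        by (intro SUP_upper2[of m]) auto
    qed
    then show "\<forall>\<^sub>F k in sequentially. ereal (1 - overshoot k) \<le> (SUP m\<in>{n..}. ereal (f m))"
      using eventually_gt_at_top[of n] by (rule eventually_mono[rotated])
  qed simp
  then have "1 \<le> limsup (\<lambda>n. ereal (f n))"
    unfolding limsup_INF_SUP by (intro INF_greatest)
  moreover have "limsup (\<lambda>n. ereal (f n)) \<le> 1"
    using f_le by (intro Limsup_bounded always_eventually allI) (simp add: one_ereal_def)
  ultimately show ?thesis
    unfolding superspeedable_def using left_approximation_pos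
    by (intro exI[of _ pos]) (simp add: real_pos f_def)
qed

section \<open>Schnorr randomness of the limit\<close>

text \<open>A half-open cell counts only if its left end is above \<open>lower\<close> and its right
  end at most \<open>upper\<close>, which places it inside the open interval.\<close>

lemma region_subset: "region e u \<subseteq> (\<Union>q\<in>{q. interval_code e q \<noteq> 0}. {lower e q<..<upper e q})"
proof
  fix y assume "y \<in> region e u"
  then obtain q where q: "interval_code e q \<noteq> 0"
    "lower e q < of_int \<lfloor>y * 2 ^ resol u\<rfloor> / 2 ^ resol u"
    "(of_int \<lfloor>y * 2 ^ resol u\<rfloor> + 1) / 2 ^ resol u \<le> upper e q"
    unfolding region_iff by blast
  have "of_int \<lfloor>y * 2 ^ resol u\<rfloor> / 2 ^ resol u \<le> y"
    "y < (of_int \<lfloor>y * 2 ^ resol u\<rfloor> + 1) / 2 ^ resol u"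
    by (simp_all add: pos_divide_le_eq pos_less_divide_eq)
  then show "y \<in> (\<Union>q\<in>{q. interval_code e q \<noteq> 0}. {lower e q<..<upper e q})"
    using q by force
qed

text \<open>Once the mesh is below the distance \<open>d\<close> to the end points, every cell that
  meets {a..b} lies inside the open interval.\<close>

lemma interval_in_region:
  assumes "interval_code e q \<noteq> 0" "lower e q < a" "b < upper e q"
  shows "\<exists>u0. \<forall>u\<ge>u0. {a..b} \<subseteq> region e u"
proof -
  define d where "d = min (a - lower e q) (upper e q - b)"
  have d: "0 < d" "lower e q + d \<le> a" "b + d \<le> upper e q"
    using assms(2,3) unfolding d_def by auto
  \<comment> \<open>Large enough for the mesh, as 2^(u^2) >= 2^u > u > 1 / d, for the window from -u
    to u, and for the index \<open>q\<close>.\<close>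
  obtain u0 :: nat where u0: "1 / d + \<bar>a\<bar> + \<bar>b\<bar> + real q < real u0"
    using reals_Archimedean2 by blast
  have "{a..b} \<subseteq> region e u" if "u0 \<le> u" for u
  proof
    fix y assume y: "y \<in> {a..b}"
    have u: "1 / d + \<bar>a\<bar> + \<bar>b\<bar> + real q < real u"
      using u0 that by linarith
    have "0 < 1 / d" using d by simp
    moreover have "a \<le> y" "y \<le> b" using y by auto
    ultimately have "real q < real u" "- real u \<le> y" "y < real u" "1 / d < real u" "0 < real u"
      using u by linarith+
    then have bounds: "q < u" "- real u \<le> y" "y < real u" "1 / d < real u" "0 < u"
      by auto
    define N :: real where "N = 2 ^ resol u"
    have "real u \<le> real (2 ^ u)"
      using less_exp[of u] by (simp only: of_nat_le_iff less_imp_le)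
    also have "\<dots> \<le> N"
      unfolding N_def using bounds(5) by (simp add: resol_def power_increasing)
    finally have N: "1 / d < N" "0 < N"
      using bounds(4,5) by auto
    then have Nd: "1 / N < d"
      using d(1) by (simp add: field_simps)
    have "(y * N - 1) / N < of_int \<lfloor>y * N\<rfloor> / N"
      using N(2) by (intro divide_strict_right_mono) linarith+
    then have "y - 1 / N < of_int \<lfloor>y * N\<rfloor> / N"
      using N(2) by (simp add: diff_divide_distrib)
    moreover have "(of_int \<lfloor>y * N\<rfloor> + 1) / N \<le> y + 1 / N"
      using N(2) by (simp add: field_simps)
    ultimately have "lower e q < of_int \<lfloor>y * N\<rfloor> / N" "(of_int \<lfloor>y * N\<rfloor> + 1) / N \<le> upper e q"
      using Nd d y by auto
    then show "y \<in> region e u"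
      unfolding region_iff N_def[symmetric] using assms(1) bounds by blast
  qed
  then show ?thesis by blast
qed

text \<open>One computable function yields both end points, and \<open>e\<close> is a code of it.
  The member number \<open>resol e\<close> may depend on \<open>e\<close> because it is part of the
  argument.\<close>

lemma schnorr_test_index:
  assumes "uniformly_effectively_open U"
  shows "\<exists>e. U (resol e) = (\<Union>q\<in>{q. interval_code e q \<noteq> 0}. {lower e q<..<upper e q})"
proof -
  obtain a b where ab: "computable_rat_seq a" "computable_rat_seq b"
    "\<And>n. U n = (\<Union>k. {real_of_rat (a (prod_encode (n, k))) <..< real_of_rat (b (prod_encode (n, k)))})"
    using assms unfolding uniformly_effectively_open_def by blast
  obtain a1 a2 a3 where a: "computable a1" "computable a2" "computable a3"
    "\<And>n. a n = (of_nat (a1 n) - of_nat (a2 n)) / of_nat (Suc (a3 n))"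
    using ab(1) unfolding computable_rat_seq_def by blast
  obtain b1 b2 b3 where b: "computable b1" "computable b2" "computable b3"
    "\<And>n. b n = (of_nat (b1 n) - of_nat (b2 n)) / of_nat (Suc (b3 n))"
    using ab(2) unfolding computable_rat_seq_def by blast
  define F where "F n = prod_encode (prod_encode (a1 n, prod_encode (a2 n, a3 n)),
      prod_encode (b1 n, prod_encode (b2 n, b3 n)))" for n
  have "computable F"
    unfolding F_def by (intro computable.pair a b)
  then obtain e where e: "\<And>x. \<exists>s. universal e x s = Suc (F x)"
    "\<And>x s. universal e x s \<in> {0, Suc (F x)}"
    using universal_complete by blast
  have F: "rat_of_code (fst (prod_decode (F n))) = real_of_rat (a n)"
    "rat_of_code (snd (prod_decode (F n))) = real_of_rat (b n)" for n
    unfolding rat_of_code_def F_def a(4) b(4)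
    by (simp_all add: of_rat_divide of_rat_diff of_rat_of_nat_eq of_rat_add)
  have val: "{lower e q<..<upper e q} = {real_of_rat (a (prod_encode (resol e, fst (prod_decode q)))) <..<
      real_of_rat (b (prod_encode (resol e, fst (prod_decode q))))}" if "interval_code e q \<noteq> 0" for q
    using e(2)[of "prod_encode (resol e, fst (prod_decode q))" "snd (prod_decode q)"] that
    unfolding lower_def upper_def interval_code_def by (simp add: F)
  have "\<exists>q. interval_code e q \<noteq> 0 \<and> fst (prod_decode q) = k" for k
  proof -
    obtain s where "universal e (prod_encode (resol e, k)) s = Suc (F (prod_encode (resol e, k)))"
      using e(1) by blast
    then show ?thesis
      by (intro exI[of _ "prod_encode (k, s)"]) (simp add: interval_code_def)
  qed
  then have "U (resol e) = (\<Union>q\<in>{q. interval_code e q \<noteq> 0}. {lower e q<..<upper e q})"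
    unfolding ab(3) by (auto simp: val) (metis greaterThanLessThan_iff)+
  then show ?thesis by blast
qed

text \<open>The measures of the regions increase to exactly \<open>weight e\<close>: they never
  exceed it and eventually come within \<open>weight (Suc k)\<close>. Here the exact measure
  demanded of a Schnorr test enters.\<close>

lemma newly_exists:
  assumes U: "U = (\<Union>q\<in>{q. interval_code e q \<noteq> 0}. {lower e q<..<upper e q})"
    and "emeasure lborel U = ennreal (weight e)" "e \<le> k"
  shows "\<exists>u. newly e k u"
proof -
  have Un: "(\<Union>u. region e u) = U"
  proof
    show "(\<Union>u. region e u) \<subseteq> U"
      unfolding U using region_subset by blast
    show "U \<subseteq> (\<Union>u. region e u)"
    proof
      fix y assume "y \<in> U"
      then obtain q where "interval_code e q \<noteq> 0" "lower e q < y" "y < upper e q"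
        unfolding U by auto
      from interval_in_region[OF this] show "y \<in> (\<Union>u. region e u)"
        by force
    qed
  qed
  have "(\<lambda>u. measure lborel (region e u)) \<longlonglongrightarrow> measure lborel (\<Union>u. region e u)"
    using fmeasurableD[OF region_measure(1)] region_mono assms(2)
    by (intro Lim_measure_incseq) (auto simp: Un incseq_def)
  moreover have U_weight: "measure lborel U = weight e"
    using assms(2) weight_pos[of e] by (simp add: measure_def)
  ultimately have lim: "(\<lambda>u. measure lborel (region e u)) \<longlonglongrightarrow> weight e"
    by (simp add: Un)
  have "\<forall>\<^sub>F u in sequentially. weight e - weight (Suc k) < measure lborel (region e u)"
    using lim by (rule order_tendstoD(1)) (simp add: weight_pos)
  then have "\<forall>\<^sub>F u in sequentially. weight e - weight (Suc k) < measure lborel (region e u) \<and> k < u"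
    using eventually_gt_at_top[of k] by (rule eventually_conj)
  then obtain u where u: "weight e - weight (Suc k) < measure lborel (region e u)" "k < u"
    using eventually_happens'[OF trivial_limit_sequentially] by blast
  have "measure lborel (region e u) \<le> weight e"
    using region_mono by (intro incseq_le[OF _ lim])
      (auto simp: incseq_def intro!: measure_mono_fmeasurable region_measure(1) fmeasurableD)
  then have "reached e k u"
    unfolding reached_iff using u assms(3) by simp
  then show ?thesis
    using reached_newly by blast
qed

lemma schnorr_random_limit: "schnorr_random limit_pos"
  unfolding schnorr_random_def
proof
  assume "\<exists>U. schnorr_test U \<and> covers U limit_pos"
  then obtain U where U: "uniformly_effectively_open U"
    "\<And>n. emeasure lborel (U n) = ennreal (1 / 2 ^ n)" "\<And>n. limit_pos \<in> U n"
    unfolding schnorr_test_def covers_def by blast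
  obtain e where e: "U (resol e) = (\<Union>q\<in>{q. interval_code e q \<noteq> 0}. {lower e q<..<upper e q})"
    using schnorr_test_index[OF U(1)] by blast
  obtain q where q: "interval_code e q \<noteq> 0" "lower e q < limit_pos" "limit_pos < upper e q"
    using U(3)[of "resol e"] unfolding e by auto
  obtain a b where ab: "lower e q < a" "a < limit_pos" "limit_pos < b" "b < upper e q"
    using dense[OF q(2)] dense[OF q(3)] by blast
  obtain u0 where u0: "\<And>u. u0 \<le> u \<Longrightarrow> {a..b} \<subseteq> region e u"
    using interval_in_region[OF q(1) ab(1,4)] by blast
  \<comment> \<open>The choice \<open>max u0 e\<close> forces \<open>u > u0\<close>, so that the
    released region already contains {a..b}.\<close>
  obtain u where u: "newly e (max u0 e) u"
    using newly_exists[OF e, of "max u0 e"] U(2) by (auto simp: weight_def)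
  then have "max u0 e < u"
    unfolding newly_def reached_def by blast
  then have "{a..b} \<subseteq> region e u" "0 < u"
    using u0 by auto
  have "\<forall>\<^sub>F s in sequentially. a < rpos s \<and> u \<le> s"
    by (intro eventually_conj order_tendstoD(1)[OF rpos_tendsto ab(2)] eventually_ge_at_top)
  then obtain s where s: "a < rpos s" "u \<le> s"
    using eventually_happens'[OF trivial_limit_sequentially] by blast
  have sb: "rpos s < b"
    using rpos_less_limit[of s] ab(3) by linarith
  have "{a..b} \<subseteq> shadow s"
    using \<open>{a..b} \<subseteq> region e u\<close> region_newly[OF u s(2)] released_subset_shadow by blast
  \<comment> \<open>The avoided set fills the interval from \<open>rpos s\<close> to
    \<open>b\<close>, a density of 1 that no slope permits.\<close>
  then have "shadow s \<inter> {rpos s..<b} = {rpos s..<b}"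
    using s(1) by force
  then have "mass s (rpos s) b = b - rpos s"
    unfolding mass_def using sb by simp
  moreover have "mass s (rpos s) b \<le> slope (level s) * (b - rpos s)"
    using mass_right[of s b] sb s(2) \<open>0 < u\<close> by simp
  moreover have "slope (level s) * (b - rpos s) < 1 * (b - rpos s)"
    using slope_bounds[of "level s"] sb by (intro mult_strict_right_mono) auto
  ultimately show False by simp
qed

theorem theorem21: "\<exists>x :: real. superspeedable x \<and> schnorr_random x"
  using superspeedable_limit schnorr_random_limit by blast

end
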